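(* Let $H$ be a Tonelli Hamiltonian on $\mathbb T^d$ with associated Lagrangian $L$. Let $(h_n)$ be mesh sizes and $(\tau_n)$ positive time steps with $\tau_n\to0$, $h_n\to0$ and $h_n/\tau_n\to0$. For each $n$ let $\mu^{h_n,\tau_n}\in\mathcal H_{h_n,\tau_n}$ be a fully-discrete Mather measure and set $\widetilde\mu^{h_n,\tau_n}:=\mathcal R_{h_n,\tau_n}\mu^{h_n,\tau_n}$. Then the family $(\widetilde\mu^{h_n,\tau_n})_n$ is tight in $\mathcal P(\mathbb T^d\times\mathbb R^d)$. Moreover, every narrow accumulation point of it is a continuous Mather measure.
   Context: $\mathbb T^d=\mathbb R^d/\mathbb Z^d$. $H\in C^2(\mathbb T^d\times\mathbb R^d)$ is a Tonelli Hamiltonian: $D^2_{pp}H(x,p)>0$ everywhere and $H$ is superlinear in $p$. The Tonelli Lagrangian is $L(x,v)=\sup_{p\in\mathbb R^d}\{p\cdot v-H(x,p)\}$; it is of class $C^2$, strictly convex in $v$, and superlinear: for every $K>0$ there is $C(K)\in\mathbb R$ with $L(x,v)\ge K|v|-C(K)$ for all $(x,v)$. A probability measure $\mu$ on $\mathbb T^d\times\mathbb R^d$ is closed if $\int v\cdot D\phi(x)\,d\mu(x,v)=0$ for all $\phi\in C^1(\mathbb T^d)$. A (continuous) Mather measure is a closed probability measure minimizing $\int L\,d\mu$ among all closed probability measures; the minimum equals $-\alpha(H)$, where $\alpha(H)$ is the unique constant for which $H(x,Du)=\alpha(H)$ on $\mathbb T^d$ has a viscosity solution. Narrow convergence is convergence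 against bounded continuous functions. Mesh sizes are always of the form $h=1/N$ with $N\ge1$ an integer. The grid is $\mathcal G_h=\{x_i=ih \bmod \mathbb Z^d: i\in\{0,\dots,N-1\}^d\}$, and each grid point is identified with its representative in $[0,1)^d$. For $x_i,x_j\in\mathcal G_h$, $\ell\in\mathbb Z^d$ put $v_{ij}^\ell=(x_j+\ell-x_i)/\tau$. $\mathcal H_{h,\tau}$ is the set of fully-discrete holonomic probability measures: families $\mu=(\mu_{ij}^\ell)$ indexed by $x_i,x_j\in\mathcal G_h$, $\ell\in\mathbb Z^d$, with $\mu_{ij}^\ell\ge0$, $\sum_{i,j,\ell}\mu_{ij}^\ell=1$ and $\sum_{j,\ell}\mu_{ij}^\ell=\sum_{j,\ell}\mu_{ji}^\ell$ for every $x_i\in\mathcal G_h$. A fully-discrete Mather measure is a minimizer of $\sum_{i,j,\ell}L(x_i,v_{ij}^\ell)\mu_{ij}^\ell$ over $\mathcal H_{h,\tau}$. The reconstruction of $\mu\in\mathcal H_{h,\tau}$ is $\mathcal R_{h,\tau}\mu=\sum_{i,j,\ell}\mu_{ij}^\ell\,\delta_{(x_i,v_{ij}^\ell)}\in\mathcal P(\mathbb T^d\times\mathbb R^d)$. *)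

theory Defs
  imports "HOL-Analysis.Analysis" "HOL-Probability.Probability_Measure"
begin

section \<open>The torus\<close>

quotient_type (overloaded) 'd torus =
    "real ^ 'd::finite" / "\<lambda>x y. \<exists>l::int^'d. y - x = (\<chi> k. real_of_int (l $ k))"
  morphisms rep_torus to_torus
proof (rule equivpI)
  show "reflp (\<lambda>x y::real^'d. \<exists>l::int^'d. y - x = (\<chi> k. real_of_int (l $ k)))"
    by (rule reflpI, rule exI[of _ 0]) (simp add: vec_eq_iff)
  show "symp (\<lambda>x y::real^'d. \<exists>l::int^'d. y - x = (\<chi> k. real_of_int (l $ k)))"
  proof (rule sympI)
    fix x y :: "real^'d"
    assume "\<exists>l::int^'d. y - x = (\<chi> k. real_of_int (l $ k))"
    then obtain l :: "int^'d" where "y - x = (\<chi> k. real_of_int (l $ k))" ..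
    then have "x - y = (\<chi> k. real_of_int ((- l) $ k))"
      by (simp add: vec_eq_iff algebra_simps)
    then show "\<exists>l::int^'d. x - y = (\<chi> k. real_of_int (l $ k))" ..
  qed
  show "transp (\<lambda>x y::real^'d. \<exists>l::int^'d. y - x = (\<chi> k. real_of_int (l $ k)))"
  proof (rule transpI)
    fix x y z :: "real^'d"
    assume "\<exists>l::int^'d. y - x = (\<chi> k. real_of_int (l $ k))"
      and "\<exists>l::int^'d. z - y = (\<chi> k. real_of_int (l $ k))"
    then obtain l m :: "int^'d" where "y - x = (\<chi> k. real_of_int (l $ k))"
      and "z - y = (\<chi> k. real_of_int (m $ k))" by blast
    then have "z - x = (\<chi> k. real_of_int ((l + m) $ k))"
      by (simp add: vec_eq_iff algebra_simps)
    then show "\<exists>l::int^'d. z - x = (\<chi> k. real_of_int (l $ k))" ..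
  qed
qed

text \<open>The torus carries the quotient topology.\<close>

instantiation torus :: (finite) topological_space
begin

definition open_torus :: "'a torus set \<Rightarrow> bool" where
  "open_torus U \<longleftrightarrow> open (to_torus -` U)"

instance
  by standard (auto simp: open_torus_def vimage_Union)

end

section \<open>Tonelli Hamiltonians and Lagrangians\<close>

definition C1_with_derivative ::
  "('a::real_normed_vector \<Rightarrow> 'b::real_normed_vector) \<Rightarrow> ('a \<Rightarrow> 'a \<Rightarrow>\<^sub>L 'b) \<Rightarrow> bool" where
  "C1_with_derivative f f' \<longleftrightarrow>
     (\<forall>z. (f has_derivative blinfun_apply (f' z)) (at z)) \<and> continuous_on UNIV f'"

definition superlinear :: "('d::finite torus \<Rightarrow> real^'d \<Rightarrow> real) \<Rightarrow> bool" where
  "superlinear F \<longleftrightarrow> (\<forall>K>0. \<exists>C. \<forall>x p. F x p \<ge> K * norm p - C)"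

text \<open>Regularity on the torus is regularity of the periodic lift.  \<open>D2 z (0,q) (0,q)\<close> is the
  quadratic form of the Hessian in \<open>p\<close> at the vector \<open>q\<close>.\<close>

definition tonelli_hamiltonian :: "('d::finite torus \<Rightarrow> real^'d \<Rightarrow> real) \<Rightarrow> bool" where
  "tonelli_hamiltonian H \<longleftrightarrow>
     (\<exists>D D2. C1_with_derivative (\<lambda>z :: (real^'d) \<times> (real^'d). H (to_torus (fst z)) (snd z)) D
           \<and> C1_with_derivative D D2
           \<and> (\<forall>z q. q \<noteq> 0 \<longrightarrow> blinfun_apply (blinfun_apply (D2 z) (0, q)) (0, q) > 0))
     \<and> superlinear H"

definition lagrangian ::
  "('d::finite torus \<Rightarrow> real^'d \<Rightarrow> real) \<Rightarrow> 'd torus \<Rightarrow> real^'d \<Rightarrow> real" where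
  "lagrangian H x v = (SUP p. p \<bullet> v - H x p)"

section \<open>Probability measures, tightness and narrow convergence\<close>

definition borel_probability :: "'a::topological_space measure \<Rightarrow> bool" where
  "borel_probability M \<longleftrightarrow> prob_space M \<and> sets M = sets borel"

definition tight_seq :: "(nat \<Rightarrow> 'a::topological_space measure) \<Rightarrow> bool" where
  "tight_seq M \<longleftrightarrow> (\<forall>n. borel_probability (M n)) \<and>
     (\<forall>\<epsilon>>0. \<exists>K. compact K \<and> (\<forall>n. measure (M n) K \<ge> 1 - \<epsilon>))"

definition narrowly_converges ::
  "(nat \<Rightarrow> 'a::topological_space measure) \<Rightarrow> 'a measure \<Rightarrow> bool" where
  "narrowly_converges M \<mu> \<longleftrightarrow>
     (\<forall>f :: 'a \<Rightarrow> real. continuous_on UNIV f \<and> bounded (range f)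
        \<longrightarrow> (\<lambda>n. \<integral>z. f z \<partial>M n) \<longlonglongrightarrow> (\<integral>z. f z \<partial>\<mu>))"

definition narrow_accumulation_point ::
  "(nat \<Rightarrow> 'a::topological_space measure) \<Rightarrow> 'a measure \<Rightarrow> bool" where
  "narrow_accumulation_point M \<mu> \<longleftrightarrow> borel_probability \<mu> \<and>
     (\<exists>r :: nat \<Rightarrow> nat. strict_mono r \<and> narrowly_converges (\<lambda>k. M (r k)) \<mu>)"

section \<open>Continuous Mather measures\<close>

text \<open>\<open>\<phi>\<close> is of class \<open>C\<^sup>1\<close> on the torus with gradient field \<open>G\<close>.\<close>

definition C1_torus_gradient ::
  "('d::finite torus \<Rightarrow> real) \<Rightarrow> ('d torus \<Rightarrow> real^'d) \<Rightarrow> bool" where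
  "C1_torus_gradient \<phi> G \<longleftrightarrow>
     (\<forall>y. GDERIV (\<lambda>y. \<phi> (to_torus y)) y :> G (to_torus y)) \<and> continuous_on UNIV G"

text \<open>Closedness includes the existence of the integrals; requiring integrability for every
  \<open>\<phi>\<close> amounts to a finite first moment in \<open>v\<close> (test with sines and cosines).\<close>

definition closed_measure :: "('d::finite torus \<times> (real^'d)) measure \<Rightarrow> bool" where
  "closed_measure \<mu> \<longleftrightarrow> borel_probability \<mu> \<and>
     (\<forall>\<phi> G. C1_torus_gradient \<phi> G \<longrightarrow> has_bochner_integral \<mu> (\<lambda>(x, v). v \<bullet> G x) 0)"

text \<open>A Tonelli Lagrangian is continuous and bounded below, so under a probability measure its
  integral is \<open>\<infinity>\<close> whenever it is not integrable.  The same convention is used for the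
  discrete action.\<close>

definition action ::
  "('d::finite torus \<Rightarrow> real^'d \<Rightarrow> real) \<Rightarrow> ('d torus \<times> (real^'d)) measure \<Rightarrow> ereal" where
  "action L \<mu> = (if integrable \<mu> (\<lambda>(x, v). L x v)
                 then ereal (\<integral>(x, v). L x v \<partial>\<mu>) else \<infinity>)"

definition mather_measure ::
  "('d::finite torus \<Rightarrow> real^'d \<Rightarrow> real) \<Rightarrow> ('d torus \<times> (real^'d)) measure \<Rightarrow> bool" where
  "mather_measure L \<mu> \<longleftrightarrow> closed_measure \<mu> \<and>
     (\<forall>\<nu>. closed_measure \<nu> \<longrightarrow> action L \<mu> \<le> action L \<nu>)"

section \<open>Fully-discrete Mather measures\<close>

text \<open>For the mesh size \<open>h = 1/N\<close>, grid points are addressed by their multi-indices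
  \<open>i \<in> {0..N-1}\<^sup>d\<close>; \<open>grid_point N i\<close> is the representative in \<open>[0,1)\<^sup>d\<close>.
  Families are functions \<open>\<mu> i j l\<close> whose values at other indices are irrelevant.\<close>

definition grid_idx :: "nat \<Rightarrow> (nat ^ 'd::finite) set" where
  "grid_idx N = {i. \<forall>k. i $ k < N}"

definition grid_point :: "nat \<Rightarrow> nat ^ 'd \<Rightarrow> real ^ 'd::finite" where
  "grid_point N i = (\<chi> k. real (i $ k) * (1 / real N))"

definition velocity ::
  "nat \<Rightarrow> real \<Rightarrow> nat ^ 'd \<Rightarrow> nat ^ 'd \<Rightarrow> int ^ 'd \<Rightarrow> real ^ 'd::finite" where
  "velocity N \<tau> i j l =
     (1 / \<tau>) *\<^sub>R (grid_point N j + (\<chi> k. real_of_int (l $ k)) - grid_point N i)"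

type_synonym 'd weights = "nat ^ 'd \<Rightarrow> nat ^ 'd \<Rightarrow> int ^ 'd \<Rightarrow> real"

definition weight_idx ::
  "nat \<Rightarrow> ((nat ^ 'd) \<times> (nat ^ 'd) \<times> (int ^ 'd::finite)) set" where
  "weight_idx N = grid_idx N \<times> grid_idx N \<times> UNIV"

definition discrete_holonomic :: "nat \<Rightarrow> ('d::finite) weights set" where
  "discrete_holonomic N = {\<mu>.
     (\<forall>i\<in>grid_idx N. \<forall>j\<in>grid_idx N. \<forall>l. 0 \<le> \<mu> i j l) \<and>
     ((\<lambda>(i, j, l). \<mu> i j l) has_sum 1) (weight_idx N) \<and>
     (\<forall>i\<in>grid_idx N. (\<Sum>\<^sub>\<infinity>(j, l)\<in>grid_idx N \<times> UNIV. \<mu> i j l)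
                      = (\<Sum>\<^sub>\<infinity>(j, l)\<in>grid_idx N \<times> UNIV. \<mu> j i l))}"

definition discrete_action ::
  "('d::finite torus \<Rightarrow> real^'d \<Rightarrow> real) \<Rightarrow> nat \<Rightarrow> real \<Rightarrow> 'd weights \<Rightarrow> ereal" where
  "discrete_action L N \<tau> \<mu> =
     (let a = (\<lambda>(i, j, l). L (to_torus (grid_point N i)) (velocity N \<tau> i j l) * \<mu> i j l)
      in if a summable_on weight_idx N then ereal (infsum a (weight_idx N)) else \<infinity>)"

definition discrete_mather_measure ::
  "('d::finite torus \<Rightarrow> real^'d \<Rightarrow> real) \<Rightarrow> nat \<Rightarrow> real \<Rightarrow> 'd weights \<Rightarrow> bool" where
  "discrete_mather_measure L N \<tau> \<mu> \<longleftrightarrow> \<mu> \<in> discrete_holonomic N \<and>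
     (\<forall>\<nu>\<in>discrete_holonomic N. discrete_action L N \<tau> \<mu> \<le> discrete_action L N \<tau> \<nu>)"

text \<open>The weighted sum of Dirac masses, as the image of the discrete measure with weights
  \<open>\<mu>\<close>; see \<open>emeasure_reconstruction\<close>.\<close>

definition reconstruction ::
  "nat \<Rightarrow> real \<Rightarrow> ('d::finite) weights \<Rightarrow> ('d torus \<times> (real^'d)) measure" where
  "reconstruction N \<tau> \<mu> =
     distr (density (count_space (weight_idx N)) (\<lambda>(i, j, l). ennreal (\<mu> i j l))) borel
       (\<lambda>(i, j, l). (to_torus (grid_point N i), velocity N \<tau> i j l))"

lemma emeasure_reconstruction:
  assumes "A \<in> sets borel"
  shows "emeasure (reconstruction N \<tau> \<mu>) A =
    (\<integral>\<^sup>+(i, j, l). ennreal (\<mu> i j l) *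
        indicator A (to_torus (grid_point N i), velocity N \<tau> i j l) \<partial>count_space (weight_idx N))"
  using assms unfolding reconstruction_def
  by (subst emeasure_distr)
     (auto simp: emeasure_density split_beta' indicator_def intro!: nn_integral_cong)

end

theory Submission
  imports Defs
begin

text \<open>The unit mass at rest bounds the discrete minima from above, so superlinearity of \<open>L\<close>
  gives tightness and uniform integrability of \<open>v\<close>.  Hence limits are closed (compare
  \<open>v \<bullet> D\<phi>(x)\<close> with the difference quotient of \<open>\<phi>\<close>, whose discrete integral vanishes), and the
  action is lower semicontinuous.

  For optimality, linear programming duality for the discrete problem with minimum \<open>m\<close> yields a
  grid function \<open>u\<close> with \<open>u\<^sub>j - u\<^sub>i \<le> L(x\<^sub>i, v) - m\<close> for every admissible velocity \<open>v\<close>.  Since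
  \<open>h / \<tau> \<rightarrow> 0\<close>, the oscillation of \<open>\<tau> u\<close> is bounded uniformly.  Averaging \<open>\<tau> u\<close> over
  grid translates against a fixed smooth kernel therefore gives \<open>C\<^sup>1\<close> functions with equicontinuous
  gradients satisfying \<open>v \<bullet> D\<phi>(x) \<le> L(x, v) - m + \<delta>\<close> once \<open>\<tau>\<close>, \<open>h\<close> and \<open>h / \<tau>\<close> are small.
  Integrating this against a closed measure bounds its action from below by \<open>m - \<delta>\<close>.\<close>

section \<open>The torus\<close>

text \<open>Optimality needs only lower bounds on continuous actions, so no closed measure is ever
  discretized; the dual potentials are carried to the continuum instead. The obstacle is that they
  live on the grid only and have no regularity there. Their inequality, however, survives grid
  translations up to a change of base point in \<open>L\<close>, hence also averages over such
  translations. The kernel is a trigonometric polynomial of degree \<open>M\<close>: the grid sums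
  that matter are then exact as soon as \<open>M + 1 < N\<close>, and no quadrature error arises.
  \<open>M\<close> is fixed by the tolerance and a velocity radius before \<open>n\<close> grows, so
  the gradient bound and the Taylor modulus of the kernel do not depend on \<open>n\<close>. The
  three limits act separately: \<open>\<tau> \<rightarrow> 0\<close> makes a Taylor expansion over
  one time step legitimate, \<open>h \<rightarrow> 0\<close> supplies enough nodes for exactness,
  and \<open>h / \<tau> \<rightarrow> 0\<close> makes admissible velocities dense and lets chains of
  bounded speed join any two grid points. Distance on the torus is measured by
  \<open>1 - cos\<close>, whose kernel average has a closed form.\<close>

definition zvec :: "int^'d \<Rightarrow> real^'d::finite" where
  "zvec l = (\<chi> k. real_of_int (l $ k))"

lemma to_torus_eq_iff: "to_torus x = to_torus y \<longleftrightarrow> (\<exists>l. y = x + zvec l)"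
  unfolding torus.abs_eq_iff zvec_def by (metis add_diff_cancel_left' add.commute diff_add_cancel)

lemma to_torus_add_zvec [simp]: "to_torus (x + zvec l) = to_torus x"
  using to_torus_eq_iff by metis

lemma zvec_uminus: "zvec (- l) = - zvec l"
  by (simp add: zvec_def vec_eq_iff)

lemma zvec_add: "zvec (l + m) = zvec l + zvec m"
  by (simp add: zvec_def vec_eq_iff)

lemma to_torus_rep [simp]: "to_torus (rep_torus x) = x"
  by (rule Quotient_abs_rep[OF Quotient_torus])

lemma torus_cases: obtains y where "x = to_torus y"
  by (metis to_torus_rep)

lemma continuous_to_torus: "continuous_on UNIV (to_torus :: real^'d::finite \<Rightarrow> _)"
  by (simp add: continuous_on_open_vimage open_torus_def)

lemma open_to_torus_image:
  assumes "open A"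
  shows "open (to_torus ` A :: 'd::finite torus set)"
proof -
  have "to_torus -` (to_torus ` A :: 'd torus set) = (\<Union>l. (+) (zvec l) ` A)"
    by (auto simp: to_torus_eq_iff image_iff add.commute intro: exI[of _ "- _"])
       (metis to_torus_eq_iff add.commute)
  then show ?thesis
    using assms by (auto simp: open_torus_def intro!: open_translation)
qed

text \<open>A product of quotient maps need not be a quotient map. Here \<open>to_torus\<close> is
  also open, so open boxes of the cover project to open boxes, and continuity on phase space can be
  checked on periodic lifts.\<close>

lemma open_torus_prod_iff:
  fixes A :: "('d::finite torus \<times> 'b::topological_space) set"
  shows "open A \<longleftrightarrow> open (map_prod to_torus id -` A)"
proof
  assume "open A"
  moreover have "continuous_on UNIV (map_prod to_torus id :: (real^'d) \<times> 'b \<Rightarrow> _)"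
    unfolding map_prod_def split_beta id_def
    by (intro continuous_intros continuous_on_compose2[OF continuous_to_torus]) auto
  ultimately show "open (map_prod to_torus id -` A)"
    by (auto simp: continuous_on_open_vimage)
next
  assume op: "open (map_prod to_torus id -` A)"
  show "open A"
  proof (rule open_prod_intro)
    fix z assume "z \<in> A"
    then obtain x v where z: "z = (to_torus x, v)" "(x, v) \<in> map_prod to_torus id -` A"
      by (metis id_apply map_prod_simp prod.exhaust torus_cases vimageI2)
    then obtain S T where "open S" "open T" "x \<in> S" "v \<in> T"
      "S \<times> T \<subseteq> map_prod to_torus id -` A"
      using open_prod_elim[OF op] by (metis mem_Times_iff fst_conv snd_conv)
    then show "\<exists>S T. open S \<and> open T \<and> z \<in> S \<times> T \<and> S \<times> T \<subseteq> A"
      by (intro exI[of _ "to_torus ` S"] exI[of _ T])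
         (auto simp: z open_to_torus_image)
  qed
qed

lemma continuous_on_torus_prod:
  fixes f :: "'d::finite torus \<times> 'b::topological_space \<Rightarrow> 'c::topological_space"
  assumes "continuous_on UNIV (\<lambda>(y, v). f (to_torus y, v))"
  shows "continuous_on UNIV f"
  unfolding continuous_on_open_vimage[OF open_UNIV]
proof (intro allI impI)
  fix B :: "'c set" assume "open B"
  then have "open ((\<lambda>(y, v). f (to_torus y, v)) -` B)"
    using assms by (auto simp: continuous_on_open_vimage)
  moreover have "(\<lambda>(y, v). f (to_torus y, v)) -` B = map_prod to_torus id -` (f -` B)"
    by auto
  ultimately show "open (f -` B \<inter> UNIV)"
    by (simp add: open_torus_prod_iff)
qed

lemma continuous_on_torus:
  fixes f :: "'d::finite torus \<Rightarrow> 'c::topological_space"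
  assumes "continuous_on UNIV (\<lambda>y. f (to_torus y))"
  shows "continuous_on UNIV f"
  using assms by (auto simp: continuous_on_open_vimage open_torus_def vimage_def)

lemma unit_cube_representative:
  fixes y :: "real^'d::finite"
  obtains l where "y + zvec l \<in> cbox 0 1"
proof
  show "y + zvec (\<chi> k. - \<lfloor>y $ k\<rfloor>) \<in> cbox 0 1"
    by (auto simp: mem_box_cart zvec_def) linarith+
qed

lemma compact_UNIV_torus: "compact (UNIV :: 'd::finite torus set)"
proof -
  have "x \<in> to_torus ` (cbox 0 1 :: (real^'d) set)" for x :: "'d torus"
    by (metis to_torus_add_zvec torus_cases unit_cube_representative image_eqI)
  then have "UNIV = to_torus ` (cbox 0 1 :: (real^'d) set)"
    by auto
  then show ?thesis
    by (metis compact_cbox compact_continuous_image continuous_to_torus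
        continuous_on_subset subset_UNIV)
qed

text \<open>A lattice translation brings the first point into the unit cube; a second point at
  distance below 1 then lies in the cube \<open>[-1, 2]\<close>, where compactness gives uniform
  continuity.\<close>

lemma periodic_uniformly_continuous:
  fixes f :: "(real^'d::finite) \<times> 'b::metric_space \<Rightarrow> 'c::metric_space"
  assumes cont: "continuous_on (UNIV \<times> K) f" and "compact K"
    and per: "\<And>y l v. v \<in> K \<Longrightarrow> f (y + zvec l, v) = f (y, v)"
  shows "uniformly_continuous_on (UNIV \<times> K) f"
proof -
  let ?Q = "cbox (-1) 2 \<times> K"
  have "compact ?Q"
    using assms by (intro compact_Times) auto
  then have uc: "uniformly_continuous_on ?Q f"
    by (intro compact_uniformly_continuous continuous_on_subset[OF cont]) auto
  show ?thesis
    unfolding uniformly_continuous_on_def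
  proof (intro allI impI)
    fix e :: real assume "e > 0"
    then obtain d where d: "d > 0"
      and close: "\<And>z z'. z \<in> ?Q \<Longrightarrow> z' \<in> ?Q \<Longrightarrow> dist z' z < d \<Longrightarrow> dist (f z') (f z) < e"
      using uc unfolding uniformly_continuous_on_def by metis
    show "\<exists>d>0. \<forall>z\<in>UNIV \<times> K. \<forall>z'\<in>UNIV \<times> K. dist z' z < d \<longrightarrow> dist (f z') (f z) < e"
    proof (intro exI[of _ "min d 1"] conjI ballI impI)
      fix z z' :: "(real^'d) \<times> 'b"
      assume z: "z \<in> UNIV \<times> K" "z' \<in> UNIV \<times> K" "dist z' z < min d 1"
      obtain y v y' v' where eq: "z = (y, v)" "z' = (y', v')" by fastforce
      obtain l where l: "y + zvec l \<in> cbox 0 1" by (rule unit_cube_representative)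
      have "\<bar>y' $ k - y $ k\<bar> \<le> 1" for k
        using component_le_norm_cart[of "y' - y" k] dist_fst_le[of z' z] z(3)
        by (simp add: eq dist_norm)
      then have "y + zvec l \<in> cbox (-1) 2" "y' + zvec l \<in> cbox (-1) 2"
        using l by (auto simp: mem_box_cart) (smt (verit))+
      then have "dist (f (y' + zvec l, v')) (f (y + zvec l, v)) < e"
        using z by (intro close) (auto simp: eq dist_Pair_Pair)
      then show "dist (f z') (f z) < e"
        using z per by (simp add: eq)
    qed (use d in auto)
  qed
qed

lemma periodic_uniformly_continuous1:
  fixes f :: "real^'d::finite \<Rightarrow> 'c::metric_space"
  assumes cont: "continuous_on UNIV f" and per: "\<And>y l. f (y + zvec l) = f y"
  shows "uniformly_continuous_on UNIV f"
proof -
  have "uniformly_continuous_on (UNIV \<times> {0::real}) (\<lambda>z. f (fst z) :: 'c)"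
    by (rule periodic_uniformly_continuous)
       (auto simp: per intro!: continuous_on_compose2[OF cont] continuous_intros)
  then show ?thesis
    unfolding uniformly_continuous_on_def
    by (auto simp: dist_Pair_Pair)
qed

section \<open>The Lagrangian of a Tonelli Hamiltonian\<close>

lemma continuous_on_C1_with_derivative:
  "C1_with_derivative f f' \<Longrightarrow> continuous_on UNIV f"
  unfolding C1_with_derivative_def
  by (meson continuous_at_imp_continuous_on has_derivative_continuous)

lemma tonelli_hamiltonian_continuous:
  assumes "tonelli_hamiltonian H"
  shows "continuous_on UNIV (\<lambda>(x, p). H x p)"
proof (rule continuous_on_torus_prod)
  show "continuous_on UNIV (\<lambda>(y, p). (\<lambda>(x, p). H x p) (to_torus y, p))"
    using assms unfolding tonelli_hamiltonian_def
    by (auto dest!: continuous_on_C1_with_derivative simp: split_beta)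
qed

lemma bounded_on_torus_times_compact:
  fixes F :: "'d::finite torus \<Rightarrow> 'b::topological_space \<Rightarrow> real"
  assumes "continuous_on UNIV (\<lambda>(x, p). F x p)" and "compact K"
  obtains B where "B > 0" "\<And>x p. p \<in> K \<Longrightarrow> \<bar>F x p\<bar> \<le> B"
proof -
  have "compact ((\<lambda>(x, p). F x p) ` (UNIV \<times> K))"
    using assms by (intro compact_continuous_image compact_Times compact_UNIV_torus)
      (auto intro: continuous_on_subset)
  then obtain B where "B > 0" "\<forall>r\<in>(\<lambda>(x, p). F x p) ` (UNIV \<times> K). norm r \<le> B"
    using compact_imp_bounded bounded_pos by metis
  then show ?thesis by (intro that[of B]) auto
qed

text \<open>Superlinearity with slope \<open>R + 1\<close> beats the pairing and leaves one spare
  \<open>norm p\<close>. This coercivity, uniform in \<open>x\<close>, confines near-maximizing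
  momenta to a ball.\<close>

lemma superlinear_inner_le:
  assumes "superlinear H" and "R \<ge> 0"
  obtains C where "\<And>x p v. norm v \<le> R \<Longrightarrow> p \<bullet> v - H x p \<le> C - norm p"
proof -
  obtain C where C: "\<And>x p. H x p \<ge> (R + 1) * norm p - C"
    using assms unfolding superlinear_def by (metis add_nonneg_pos zero_less_one)
  have "p \<bullet> v - H x p \<le> C - norm p" if "norm v \<le> R" for x p v
  proof -
    have "p \<bullet> v \<le> norm p * norm v" by (rule norm_cauchy_schwarz)
    also have "\<dots> \<le> norm p * R" using that by (simp add: mult_left_mono)
    finally show ?thesis using C[where x=x and p=p] by (simp add: algebra_simps)
  qed
  then show ?thesis by (rule that)
qed

text \<open>A real-valued \<open>SUP\<close> bounds its members only over a set that is bounded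
  above, and superlinearity provides that bound.\<close>

lemma lagrangian_upper:
  fixes H :: "'d::finite torus \<Rightarrow> real^'d \<Rightarrow> real"
  assumes "superlinear H"
  shows "p \<bullet> v - H x p \<le> lagrangian H x v"
proof -
  obtain C where C: "\<And>x p w. norm w \<le> norm v \<Longrightarrow> p \<bullet> w - H x p \<le> C - norm p"
    using superlinear_inner_le[OF assms norm_ge_zero[of v]] by metis
  have "p \<bullet> v - H x p \<le> C" for p
    using C[of v p x] norm_ge_zero[of p] by linarith
  then show ?thesis
    unfolding lagrangian_def by (intro cSUP_upper bdd_aboveI) auto
qed

lemma lagrangian_least:
  assumes "\<And>p. p \<bullet> v - H x p \<le> b"
  shows "lagrangian H x v \<le> b"
  unfolding lagrangian_def using assms by (intro cSUP_least) auto

text \<open>Test the supremum with the momentum of length at most \<open>K\<close> pointing along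
  \<open>v\<close>; on such momenta \<open>H\<close> is bounded by compactness.\<close>

lemma lagrangian_superlinear:
  fixes H :: "'d::finite torus \<Rightarrow> real^'d \<Rightarrow> real"
  assumes "continuous_on UNIV (\<lambda>(x, p). H x p)" and "superlinear H"
  shows "superlinear (lagrangian H)"
  unfolding superlinear_def
proof (intro allI impI)
  fix K :: real assume "K > 0"
  obtain B where B: "\<And>x p. p \<in> cball 0 K \<Longrightarrow> \<bar>H x p\<bar> \<le> B"
    using bounded_on_torus_times_compact[OF assms(1) compact_cball] by metis
  have "lagrangian H x v \<ge> K * norm v - B" for x v
  proof -
    have "(K *\<^sub>R sgn v) \<bullet> v = K * norm v"
      by (cases "v = 0") (auto simp: sgn_div_norm dot_square_norm power2_eq_square)
    moreover have "K *\<^sub>R sgn v \<in> cball 0 K"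
      using \<open>K > 0\<close> by (simp add: norm_sgn)
    ultimately show ?thesis
      using lagrangian_upper[OF assms(2), of "K *\<^sub>R sgn v" v x] B[of "K *\<^sub>R sgn v" x] by linarith
  qed
  then show "\<exists>C. \<forall>x v. lagrangian H x v \<ge> K * norm v - C" by blast
qed

text \<open>Locally in \<open>v\<close> only momenta in a fixed ball compete for the supremum, and
  there \<open>H\<close> is uniformly continuous.\<close>

lemma continuous_lagrangian:
  fixes H :: "'d::finite torus \<Rightarrow> real^'d \<Rightarrow> real"
  assumes cont: "continuous_on UNIV (\<lambda>(x, p). H x p)" and super: "superlinear H"
  shows "continuous_on UNIV (\<lambda>(x, v). lagrangian H x v)"
proof (rule continuous_on_torus_prod)
  let ?L = "\<lambda>(y, v). lagrangian H (to_torus y) v" and ?H = "\<lambda>(y, p). H (to_torus y) p"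
  have contH: "continuous_on UNIV ?H"
  proof -
    have "continuous_on UNIV (\<lambda>z. (\<lambda>(x, p). H x p) (to_torus (fst z), snd z))"
      by (rule continuous_on_compose2[OF cont])
         (auto intro!: continuous_intros continuous_on_compose2[OF continuous_to_torus])
    then show ?thesis by (simp add: split_beta)
  qed
  have "continuous (at z0) ?L" for z0
    unfolding continuous_at_eps_delta
  proof (intro allI impI)
    fix e :: real assume "e > 0"
    define R where "R = norm (snd z0) + 1"
    obtain C where C: "\<And>x p v. norm v \<le> R \<Longrightarrow> p \<bullet> v - H x p \<le> C - norm p"
      by (rule superlinear_inner_le[OF super, of R]) (auto simp: R_def)
    obtain B where B: "\<And>x. \<bar>H x 0\<bar> \<le> B"
      using bounded_on_torus_times_compact[OF cont, of "{0}"] by auto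
    \<comment> \<open>Beyond norm \<open>P\<close> the coercivity estimate falls below
      \<open>- B\<close>, which the momentum 0 already achieves.\<close>
    define P where "P = \<bar>C\<bar> + B"
    have "P \<ge> 0"
      using B[of undefined] abs_ge_zero unfolding P_def by (smt (verit))
    have "uniformly_continuous_on (UNIV \<times> cball 0 P) ?H"
      by (rule periodic_uniformly_continuous) (auto intro: continuous_on_subset[OF contH])
    then obtain d where d: "d > 0" and close: "\<And>z z'. z \<in> UNIV \<times> cball 0 P \<Longrightarrow>
        z' \<in> UNIV \<times> cball 0 P \<Longrightarrow> dist z' z < d \<Longrightarrow> dist (?H z') (?H z) < e / 3"
      using \<open>e > 0\<close> unfolding uniformly_continuous_on_def by (metis divide_pos_pos zero_less_numeral)
    \<comment> \<open>One-sided, since exchanging the two points gives the other half. One third of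
      \<open>e\<close> pays for the change of \<open>H\<close>, another for the change of the
      pairing.\<close>
    have le: "lagrangian H (to_torus y) v \<le> lagrangian H (to_torus y') v' + 2 * e / 3"
      if "norm v \<le> R" "norm v' \<le> R" "norm (y - y') < d" "norm (v - v') \<le> e / (3 * (P + 1))" for y v y' v'
    proof (rule lagrangian_least)
      fix p
      show "p \<bullet> v - H (to_torus y) p \<le> lagrangian H (to_torus y') v' + 2 * e / 3"
      proof (cases "norm p \<le> P")
        case True
        have "dist (?H (y, p)) (?H (y', p)) < e / 3"
          using True that by (intro close) (auto simp: dist_Pair_Pair dist_norm)
        then have "\<bar>H (to_torus y) p - H (to_torus y') p\<bar> < e / 3"
          by (simp add: dist_norm)
        moreover have "p \<bullet> v - p \<bullet> v' \<le> e / 3"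
        proof -
          have "p \<bullet> v - p \<bullet> v' \<le> norm p * norm (v - v')"
            by (metis inner_diff_right norm_cauchy_schwarz)
          also have "\<dots> \<le> (P + 1) * (e / (3 * (P + 1)))"
            using True that \<open>P \<ge> 0\<close> by (intro mult_mono) auto
          also have "\<dots> = e / 3" using \<open>P \<ge> 0\<close> by (simp add: field_simps)
          finally show ?thesis .
        qed
        moreover have "p \<bullet> v' - H (to_torus y') p \<le> lagrangian H (to_torus y') v'"
          by (rule lagrangian_upper[OF super])
        ultimately show ?thesis by linarith
      next
        case False
        then have "p \<bullet> v - H (to_torus y) p \<le> - B"
          using C[OF that(1), of p "to_torus y"] unfolding P_def by linarith
        also have "\<dots> \<le> lagrangian H (to_torus y') v'"
          using lagrangian_upper[OF super, of 0 v' "to_torus y'"] B[of "to_torus y'"] by auto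
        finally show ?thesis using \<open>e > 0\<close> by linarith
      qed
    qed
    show "\<exists>d>0. \<forall>z. dist z z0 < d \<longrightarrow> dist (?L z) (?L z0) < e"
    proof (intro exI[of _ "min (min d 1) (e / (3 * (P + 1)))"] conjI allI impI)
      fix z assume z: "dist z z0 < min (min d 1) (e / (3 * (P + 1)))"
      have *: "norm (fst z - fst z0) \<le> dist z z0" "norm (snd z - snd z0) \<le> dist z z0"
        using dist_fst_le[of z z0] dist_snd_le[of z z0] by (auto simp: dist_norm)
      moreover have "norm (snd z) \<le> R" "norm (snd z0) \<le> R"
        using * z norm_triangle_sub[of "snd z" "snd z0"] unfolding R_def by auto
      ultimately have "?L z \<le> ?L z0 + 2 * e / 3" "?L z0 \<le> ?L z + 2 * e / 3"
        using z le[of "snd z" "snd z0" "fst z" "fst z0"] le[of "snd z0" "snd z" "fst z0" "fst z"]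
        by (auto simp: split_beta norm_minus_commute)
      then show "dist (?L z) (?L z0) < e"
        using \<open>e > 0\<close> by (auto simp: dist_norm)
    qed (use d \<open>e > 0\<close> \<open>P \<ge> 0\<close> in auto)
  qed
  then have "continuous_on UNIV ?L"
    by (simp add: continuous_at_imp_continuous_on)
  then show "continuous_on UNIV (\<lambda>(y, v). (\<lambda>(x, v). lagrangian H x v) (to_torus y, v))"
    by simp
qed

section \<open>Discrete holonomic measures\<close>

lemma finite_grid_idx: "finite (grid_idx N :: (nat^'d::finite) set)"
proof -
  have "(grid_idx N :: (nat^'d) set) \<subseteq> vec_lambda ` (UNIV \<rightarrow>\<^sub>E {..<N})"
  proof
    fix i :: "nat^'d" assume "i \<in> grid_idx N"
    then show "i \<in> vec_lambda ` (UNIV \<rightarrow>\<^sub>E {..<N})"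
      by (intro image_eqI[of _ _ "vec_nth i"]) (auto simp: grid_idx_def)
  qed
  then show ?thesis by (rule finite_subset) (simp add: finite_PiE)
qed

lemma has_sum_finite_sum:
  fixes f :: "'a \<Rightarrow> 'b \<Rightarrow> 'c::topological_comm_monoid_add"
  assumes "finite A" and "\<And>a. a \<in> A \<Longrightarrow> (f a has_sum s a) B"
  shows "((\<lambda>x. \<Sum>a\<in>A. f a x) has_sum (\<Sum>a\<in>A. s a)) B"
  using assms by (induction A rule: finite_induct) (auto intro: has_sum_add)

text \<open>Marginals become sums over the full index set weighted by an indicator, so that balance
  conditions at different nodes can be combined linearly.\<close>

lemma has_sum_outflow:
  fixes q :: "'d::finite weights"
  assumes "(\<lambda>(i, j, l). q i j l) summable_on weight_idx N" and a: "a \<in> grid_idx N"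
  shows "((\<lambda>(i, j, l). q i j l * of_bool (i = a)) has_sum
           (\<Sum>\<^sub>\<infinity>(j, l)\<in>grid_idx N \<times> UNIV. q a j l)) (weight_idx N)"
proof -
  let ?h = "\<lambda>(j, l). (a, j, l)" and ?B = "grid_idx N \<times> (UNIV :: (int^'d) set)"
  let ?f = "\<lambda>(i, j, l). q i j l * of_bool (i = a)"
  have inj: "inj_on ?h ?B" by (auto simp: inj_on_def)
  have "?h ` ?B \<subseteq> weight_idx N" using a by (auto simp: weight_idx_def)
  then have "(\<lambda>(i, j, l). q i j l) summable_on ?h ` ?B"
    using assms(1) summable_on_subset_banach by blast
  then have "((\<lambda>(i, j, l). q i j l) \<circ> ?h) summable_on ?B"
    using summable_on_reindex[OF inj] by blast
  then have "((\<lambda>(j, l). q a j l) has_sum (\<Sum>\<^sub>\<infinity>(j, l)\<in>?B. q a j l)) ?B"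
    by (intro has_sum_infsum) (simp add: comp_def split_beta')
  then have "(?f \<circ> ?h has_sum (\<Sum>\<^sub>\<infinity>(j, l)\<in>?B. q a j l)) ?B"
    by (rule has_sum_cong[THEN iffD1, rotated]) auto
  then have "(?f has_sum (\<Sum>\<^sub>\<infinity>(j, l)\<in>?B. q a j l)) (?h ` ?B)"
    using has_sum_reindex[OF inj] by blast
  then show ?thesis
    by (rule has_sum_cong_neutral[THEN iffD1, rotated -1])
       (use a in \<open>auto simp: weight_idx_def image_iff\<close>)
qed

lemma has_sum_inflow:
  fixes q :: "'d::finite weights"
  assumes "(\<lambda>(i, j, l). q i j l) summable_on weight_idx N" and a: "a \<in> grid_idx N"
  shows "((\<lambda>(i, j, l). q i j l * of_bool (j = a)) has_sum
           (\<Sum>\<^sub>\<infinity>(j, l)\<in>grid_idx N \<times> UNIV. q j a l)) (weight_idx N)"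
proof -
  let ?h = "\<lambda>(j, l). (j, a, l)" and ?B = "grid_idx N \<times> (UNIV :: (int^'d) set)"
  let ?f = "\<lambda>(i, j, l). q i j l * of_bool (j = a)"
  have inj: "inj_on ?h ?B" by (auto simp: inj_on_def)
  have "?h ` ?B \<subseteq> weight_idx N" using a by (auto simp: weight_idx_def)
  then have "(\<lambda>(i, j, l). q i j l) summable_on ?h ` ?B"
    using assms(1) summable_on_subset_banach by blast
  then have "((\<lambda>(i, j, l). q i j l) \<circ> ?h) summable_on ?B"
    using summable_on_reindex[OF inj] by blast
  then have "((\<lambda>(j, l). q j a l) has_sum (\<Sum>\<^sub>\<infinity>(j, l)\<in>?B. q j a l)) ?B"
    by (intro has_sum_infsum) (simp add: comp_def split_beta')
  then have "(?f \<circ> ?h has_sum (\<Sum>\<^sub>\<infinity>(j, l)\<in>?B. q j a l)) ?B"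
    by (rule has_sum_cong[THEN iffD1, rotated]) auto
  then have "(?f has_sum (\<Sum>\<^sub>\<infinity>(j, l)\<in>?B. q j a l)) (?h ` ?B)"
    using has_sum_reindex[OF inj] by blast
  then show ?thesis
    by (rule has_sum_cong_neutral[THEN iffD1, rotated -1])
       (use a in \<open>auto simp: weight_idx_def image_iff\<close>)
qed

lemma discrete_holonomicD:
  assumes "\<mu> \<in> discrete_holonomic N"
  shows "\<And>i j l. (i, j, l) \<in> weight_idx N \<Longrightarrow> 0 \<le> \<mu> i j l"
    and "((\<lambda>(i, j, l). \<mu> i j l) has_sum 1) (weight_idx N)"
  using assms by (auto simp: discrete_holonomic_def weight_idx_def)

text \<open>Every \<open>g\<close> is a finite combination of point indicators, so this is the
  weighted sum of the balance equations at the nodes.\<close>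

lemma discrete_holonomic_test:
  fixes \<mu> :: "'d::finite weights" and g :: "nat^'d \<Rightarrow> real"
  assumes \<mu>: "\<mu> \<in> discrete_holonomic N"
  shows "((\<lambda>(i, j, l). \<mu> i j l * (g j - g i)) has_sum 0) (weight_idx N)"
proof -
  have summable: "(\<lambda>(i, j, l). \<mu> i j l) summable_on weight_idx N"
    using discrete_holonomicD(2)[OF \<mu>] by (auto intro: has_sum_imp_summable)
  have eq: "(\<Sum>\<^sub>\<infinity>(j, l)\<in>grid_idx N \<times> UNIV. \<mu> a j l) = (\<Sum>\<^sub>\<infinity>(j, l)\<in>grid_idx N \<times> UNIV. \<mu> j a l)"
    if "a \<in> grid_idx N" for a
    using \<mu> that by (simp add: discrete_holonomic_def)
  have "((\<lambda>e. \<Sum>a\<in>grid_idx N. g a * ((\<lambda>(i, j, l). \<mu> i j l * of_bool (j = a)) e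
        - (\<lambda>(i, j, l). \<mu> i j l * of_bool (i = a)) e)) has_sum (\<Sum>a\<in>grid_idx N. g a * 0)) (weight_idx N)"
    (is "(?S has_sum _) _")
  proof (intro has_sum_finite_sum finite_grid_idx has_sum_cmult_right)
    fix a :: "nat^'d" assume a: "a \<in> grid_idx N"
    have "((\<lambda>e. (\<lambda>(i, j, l). \<mu> i j l * of_bool (j = a)) e
        + - (\<lambda>(i, j, l). \<mu> i j l * of_bool (i = a)) e) has_sum
        (\<Sum>\<^sub>\<infinity>(j, l)\<in>grid_idx N \<times> UNIV. \<mu> a j l) + - (\<Sum>\<^sub>\<infinity>(j, l)\<in>grid_idx N \<times> UNIV. \<mu> a j l)) (weight_idx N)"
      using has_sum_inflow[OF summable a] has_sum_outflow[OF summable a]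
      by (intro has_sum_add has_sum_uminus[THEN iffD2]) (simp_all add: eq[OF a])
    then show "((\<lambda>e. (\<lambda>(i, j, l). \<mu> i j l * of_bool (j = a)) e
        - (\<lambda>(i, j, l). \<mu> i j l * of_bool (i = a)) e) has_sum 0) (weight_idx N)"
      by simp
  qed
  then have "(?S has_sum 0) (weight_idx N)" by simp
  then show ?thesis
  proof (rule has_sum_cong[THEN iffD1, rotated])
    fix e :: "(nat^'d) \<times> (nat^'d) \<times> (int^'d)" assume "e \<in> weight_idx N"
    then obtain i j l where e: "e = (i, j, l)" "i \<in> grid_idx N" "j \<in> grid_idx N"
      by (auto simp: weight_idx_def)
    have "(\<Sum>a\<in>grid_idx N. g a * (\<mu> i j l * of_bool (j = a) - \<mu> i j l * of_bool (i = a)))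
        = (\<Sum>a\<in>grid_idx N. if a = j then g a * \<mu> i j l else 0) - (\<Sum>a\<in>grid_idx N. if a = i then g a * \<mu> i j l else 0)"
      by (subst sum_subtractf[symmetric], rule sum.cong) (auto simp: algebra_simps)
    also have "\<dots> = \<mu> i j l * (g j - g i)"
      using e by (simp add: finite_grid_idx algebra_simps)
    finally show "(\<Sum>a\<in>grid_idx N. g a * ((\<lambda>(i, j, l). \<mu> i j l * of_bool (j = a)) e
        - (\<lambda>(i, j, l). \<mu> i j l * of_bool (i = a)) e)) = (\<lambda>(i, j, l). \<mu> i j l * (g j - g i)) e"
      by (simp add: e)
  qed
qed

text \<open>Testing with the indicator of a node recovers the balance equation there.\<close>

lemma discrete_holonomicI:
  fixes \<mu> :: "'d::finite weights"
  assumes nonneg: "\<And>i j l. (i, j, l) \<in> weight_idx N \<Longrightarrow> 0 \<le> \<mu> i j l"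
    and mass: "((\<lambda>(i, j, l). \<mu> i j l) has_sum 1) (weight_idx N)"
    and test: "\<And>g :: nat^'d \<Rightarrow> real. ((\<lambda>(i, j, l). \<mu> i j l * (g j - g i)) has_sum 0) (weight_idx N)"
  shows "\<mu> \<in> discrete_holonomic N"
proof -
  have "(\<Sum>\<^sub>\<infinity>(j, l)\<in>grid_idx N \<times> UNIV. \<mu> a j l) = (\<Sum>\<^sub>\<infinity>(j, l)\<in>grid_idx N \<times> UNIV. \<mu> j a l)"
    if a: "a \<in> grid_idx N" for a
  proof -
    have summable: "(\<lambda>(i, j, l). \<mu> i j l) summable_on weight_idx N"
      using mass by (auto intro: has_sum_imp_summable)
    have "((\<lambda>e. (\<lambda>(i, j, l). \<mu> i j l * (of_bool (j = a) - of_bool (i = a))) e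
        + (\<lambda>(i, j, l). \<mu> i j l * of_bool (i = a)) e) has_sum
        0 + (\<Sum>\<^sub>\<infinity>(j, l)\<in>grid_idx N \<times> UNIV. \<mu> a j l)) (weight_idx N)"
      by (intro has_sum_add has_sum_outflow summable a test)
    moreover have "(\<lambda>e. (\<lambda>(i, j, l). \<mu> i j l * (of_bool (j = a) - of_bool (i = a))) e
        + (\<lambda>(i, j, l). \<mu> i j l * of_bool (i = a)) e) = (\<lambda>(i, j, l). \<mu> i j l * of_bool (j = a))"
      by (auto simp: fun_eq_iff algebra_simps)
    ultimately show ?thesis
      using has_sum_inflow[OF summable a] by (auto dest: has_sum_unique)
  qed
  then show ?thesis
    using nonneg mass by (auto simp: discrete_holonomic_def weight_idx_def)
qed

section \<open>Integration against reconstructed measures\<close>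

definition phase_point :: "nat \<Rightarrow> real \<Rightarrow> (nat^'d) \<times> (nat^'d) \<times> (int^'d) \<Rightarrow> 'd::finite torus \<times> (real^'d)" where
  "phase_point N \<tau> = (\<lambda>(i, j, l). (to_torus (grid_point N i), velocity N \<tau> i j l))"

text \<open>Summability of a real family is absolute, hence the same as integrability for counting
  measure; density and image then transport the integral.\<close>

lemma reconstruction_integral:
  fixes f :: "'d::finite torus \<times> (real^'d) \<Rightarrow> real"
  assumes \<mu>: "\<mu> \<in> discrete_holonomic N" and f: "f \<in> borel_measurable borel"
    and sum: "((\<lambda>(i, j, l). \<mu> i j l * f (phase_point N \<tau> (i, j, l))) has_sum s) (weight_idx N)"
  shows "has_bochner_integral (reconstruction N \<tau> \<mu>) f s"
proof -
  let ?w = "\<lambda>(i, j, l). \<mu> i j l" and ?F = "\<lambda>(i, j, l). \<mu> i j l * f (phase_point N \<tau> (i, j, l))"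
  have "Infinite_Set_Sum.abs_summable_on ?F (weight_idx N)"
    using has_sum_imp_summable[OF sum] abs_summable_equivalent summable_on_iff_abs_summable_on_real
    by blast
  then have "has_bochner_integral (count_space (weight_idx N)) ?F s"
    using infsumI[OF sum] infsetsum_infsum[of ?F "weight_idx N"]
    unfolding abs_summable_on_def infsetsum_def has_bochner_integral_iff by simp
  then have "has_bochner_integral (count_space (weight_idx N)) (\<lambda>e. ?w e *\<^sub>R f (phase_point N \<tau> e)) s"
    by (simp add: split_beta')
  moreover have "AE e in count_space (weight_idx N). 0 \<le> ?w e"
    using discrete_holonomicD(1)[OF \<mu>] by (auto simp: AE_count_space)
  ultimately have "has_bochner_integral (density (count_space (weight_idx N)) (\<lambda>e. ennreal (?w e)))
      (\<lambda>e. f (phase_point N \<tau> e)) s"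
    by (intro has_bochner_integral_density) auto
  then have "has_bochner_integral (distr (density (count_space (weight_idx N)) (\<lambda>e. ennreal (?w e)))
      borel (phase_point N \<tau>)) f s"
    by (intro has_bochner_integral_distr f) auto
  then show ?thesis
    by (simp add: reconstruction_def phase_point_def split_beta')
qed

lemma sets_reconstruction: "sets (reconstruction N \<tau> \<mu>) = sets borel"
  by (simp add: reconstruction_def)

lemma borel_probability_reconstruction:
  assumes "\<mu> \<in> discrete_holonomic N"
  shows "borel_probability (reconstruction N \<tau> \<mu>)"
proof -
  have "has_bochner_integral (reconstruction N \<tau> \<mu>) (\<lambda>_. 1 :: real) 1"
    using discrete_holonomicD[OF assms] by (intro reconstruction_integral assms) auto
  then have "prob_space (reconstruction N \<tau> \<mu>)"
    by (intro prob_spaceI, cases "emeasure (reconstruction N \<tau> \<mu>) (space (reconstruction N \<tau> \<mu>))")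
       (auto simp: has_bochner_integral_iff measure_def)
  then show ?thesis by (simp add: borel_probability_def sets_reconstruction)
qed

section \<open>Duality for the discrete problem\<close>

text \<open>A flow of one unit from \<open>a\<close> to \<open>b\<close>, of total mass \<open>T\<close> and cost \<open>A\<close>.  The divergence
  condition is stated in weak form, so that concatenation of flows is addition.\<close>

definition unit_flow :: "nat \<Rightarrow> 'd::finite weights \<Rightarrow> nat^'d \<Rightarrow> nat^'d \<Rightarrow> real \<Rightarrow> real \<Rightarrow> 'd weights \<Rightarrow> bool" where
  "unit_flow N c a b T A q \<longleftrightarrow> T \<ge> 0 \<and>
     (\<forall>(i, j, l)\<in>weight_idx N. 0 \<le> q i j l) \<and>
     ((\<lambda>(i, j, l). q i j l) has_sum T) (weight_idx N) \<and>
     ((\<lambda>(i, j, l). c i j l * q i j l) has_sum A) (weight_idx N) \<and>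
     (\<forall>g :: nat^'d \<Rightarrow> real. ((\<lambda>(i, j, l). q i j l * (g j - g i)) has_sum (g b - g a)) (weight_idx N))"

lemma unit_flow_add:
  assumes "unit_flow N c a b T A q" and "unit_flow N c b d T' A' q'"
  shows "unit_flow N c a d (T + T') (A + A') (\<lambda>i j l. q i j l + q' i j l)"
proof -
  let ?q = "\<lambda>i j l. q i j l + q' i j l"
  have "((\<lambda>(i, j, l). ?q i j l * (g j - g i)) has_sum (g d - g a)) (weight_idx N)" for g :: "nat^'a \<Rightarrow> real"
    using has_sum_add[of "\<lambda>(i, j, l). q i j l * (g j - g i)" "weight_idx N" "g b - g a"
        "\<lambda>(i, j, l). q' i j l * (g j - g i)" "g d - g b"] assms
    by (simp add: unit_flow_def case_prod_unfold distrib_right)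
  moreover have "((\<lambda>(i, j, l). ?q i j l) has_sum (T + T')) (weight_idx N)"
    using has_sum_add[of "\<lambda>(i, j, l). q i j l" "weight_idx N" T "\<lambda>(i, j, l). q' i j l" T'] assms
    by (simp add: unit_flow_def case_prod_unfold)
  moreover have "((\<lambda>(i, j, l). c i j l * ?q i j l) has_sum (A + A')) (weight_idx N)"
    using has_sum_add[of "\<lambda>(i, j, l). c i j l * q i j l" "weight_idx N" A
        "\<lambda>(i, j, l). c i j l * q' i j l" A'] assms
    by (simp add: unit_flow_def case_prod_unfold distrib_left)
  moreover have "\<forall>(i, j, l)\<in>weight_idx N. 0 \<le> ?q i j l" "0 \<le> T + T'"
    using assms by (fastforce simp: unit_flow_def)+
  ultimately show ?thesis
    unfolding unit_flow_def by blast
qed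

lemma unit_flow_edge:
  assumes "i \<in> grid_idx N" and "j \<in> grid_idx N"
  shows "unit_flow N c i j 1 (c i j l) (\<lambda>i' j' l'. of_bool ((i', j', l') = (i, j, l)))"
proof -
  have "((\<lambda>(i', j', l'). of_bool ((i', j', l') = (i, j, l)) * F i' j' l') has_sum F i j l) (weight_idx N)"
    for F :: "nat^'a \<Rightarrow> nat^'a \<Rightarrow> int^'a \<Rightarrow> real"
    using assms by (intro has_sum_finite_neutralI[of "{(i, j, l)}"]) (auto simp: weight_idx_def)
  from this[of "\<lambda>_ _ _. 1"] this[of c] this[of "\<lambda>i' j' l'. _ j' - _ i'"] show ?thesis
    by (simp add: unit_flow_def mult.commute)
qed

text \<open>A flow from a node to itself has no divergence, so dividing by its mass gives a
  holonomic probability measure, to which the bound \<open>m\<close> applies.\<close>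

lemma unit_flow_cycle:
  assumes m: "\<And>\<nu> s. \<nu> \<in> discrete_holonomic N \<Longrightarrow>
      ((\<lambda>(i, j, l). c i j l * \<nu> i j l) has_sum s) (weight_idx N) \<Longrightarrow> m \<le> s"
    and q: "unit_flow N c a a T A q" and "T > 0"
  shows "m * T \<le> A"
proof -
  define \<nu> where "\<nu> = (\<lambda>i j l. q i j l / T)"
  have *: "((\<lambda>e. (1 / T) * f e) has_sum (1 / T) * s) (weight_idx N)"
    if "(f has_sum s) (weight_idx N)"
    for f :: "(nat^'a) \<times> (nat^'a) \<times> (int^'a) \<Rightarrow> real" and s
    using that by (rule has_sum_cmult_right)
  have "\<nu> \<in> discrete_holonomic N"
  proof (rule discrete_holonomicI)
    show "0 \<le> \<nu> i j l" if "(i, j, l) \<in> weight_idx N" for i j l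
      using q that \<open>T > 0\<close> unfolding unit_flow_def \<nu>_def by fastforce
    show "((\<lambda>(i, j, l). \<nu> i j l) has_sum 1) (weight_idx N)"
      using *[of "\<lambda>(i, j, l). q i j l" T] q \<open>T > 0\<close> by (simp add: unit_flow_def \<nu>_def case_prod_unfold)
    show "((\<lambda>(i, j, l). \<nu> i j l * (g j - g i)) has_sum 0) (weight_idx N)" for g :: "nat^'a \<Rightarrow> real"
      using *[of "\<lambda>(i, j, l). q i j l * (g j - g i)" 0] q by (simp add: unit_flow_def \<nu>_def case_prod_unfold)
  qed
  moreover have "((\<lambda>(i, j, l). c i j l * \<nu> i j l) has_sum (A / T)) (weight_idx N)"
    using *[of "\<lambda>(i, j, l). c i j l * q i j l" A] q by (simp add: unit_flow_def \<nu>_def case_prod_unfold)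
  ultimately have "m \<le> A / T" by (rule m)
  then show ?thesis using \<open>T > 0\<close> by (simp add: field_simps)
qed

text \<open>Linear programming duality for the discrete problem: the potential of \<open>b\<close> is the cheapest
  flow to \<open>b\<close> from a base point with respect to the reduced cost \<open>c - m\<close>.\<close>

lemma discrete_potential:
  fixes c :: "'d::finite weights"
  assumes "N \<ge> 1" and m: "\<And>\<nu> s. \<nu> \<in> discrete_holonomic N \<Longrightarrow>
      ((\<lambda>(i, j, l). c i j l * \<nu> i j l) has_sum s) (weight_idx N) \<Longrightarrow> m \<le> s"
  obtains u :: "nat^'d \<Rightarrow> real" where
    "\<And>i j l. i \<in> grid_idx N \<Longrightarrow> j \<in> grid_idx N \<Longrightarrow> u j - u i \<le> c i j l - m"
proof -
  have 0: "0 \<in> grid_idx N" using \<open>N \<ge> 1\<close> by (simp add: grid_idx_def)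
  define S where "S b = {A - m * T |T A q. unit_flow N c 0 b T A q}" for b :: "nat^'d"
  \<comment> \<open>Closing a flow with the edge from \<open>b\<close> back to 0 makes a cycle,
    which keeps the infimum below from being over an unbounded set.\<close>
  have bdd: "bdd_below (S b)" if "b \<in> grid_idx N" for b
  proof (rule bdd_belowI)
    fix r assume "r \<in> S b"
    then obtain T A q where r: "r = A - m * T" "unit_flow N c 0 b T A q" by (auto simp: S_def)
    have "m * (T + 1) \<le> A + c b 0 0"
      using unit_flow_cycle[OF m unit_flow_add[OF r(2) unit_flow_edge[OF that 0, of c 0]]] r(2)
      by (simp add: unit_flow_def)
    then show "m - c b 0 0 \<le> r" by (simp add: r algebra_simps)
  qed
  have ne: "S b \<noteq> {}" if "b \<in> grid_idx N" for b
    using unit_flow_edge[OF 0 that, of c 0] by (auto simp: S_def)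
  have "Inf (S j) - Inf (S i) \<le> c i j l - m" if ij: "i \<in> grid_idx N" "j \<in> grid_idx N" for i j l
  proof -
    \<comment> \<open>Appending the edge from \<open>i\<close> to \<open>j\<close> to any flow
      ending at \<open>i\<close> gives a competitor for the infimum at \<open>j\<close>.\<close>
    have "Inf (S j) - (c i j l - m) \<le> r" if r: "r \<in> S i" for r
    proof -
      obtain T A q where r: "r = A - m * T" "unit_flow N c 0 i T A q" using r by (auto simp: S_def)
      have "A + c i j l - m * (T + 1) \<in> S j"
        using unit_flow_add[OF r(2) unit_flow_edge[OF ij, of c l]] unfolding S_def by blast
      then have "Inf (S j) \<le> A + c i j l - m * (T + 1)"
        by (intro cInf_lower bdd ij)
      then show ?thesis by (simp add: r algebra_simps)
    qed
    then have "Inf (S j) - (c i j l - m) \<le> Inf (S i)"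
      by (intro cInf_greatest ne ij)
    then show ?thesis by simp
  qed
  then show ?thesis by (rule that)
qed

section \<open>A periodic mollifier compatible with the grid\<close>

text \<open>A geometric sum: up to a constant factor the terms are powers of an \<open>N\<close>-th
  root of unity, which differs from 1 because \<open>0 < \<bar>M - k\<bar> \<le> M < N\<close>.
  Dividing by the \<open>M\<close>-th power expresses possibly negative frequencies with natural
  exponents.\<close>

lemma sum_cis_shifted:
  assumes "M < N" and "k \<le> 2 * M" and "k \<noteq> M"
  shows "(\<Sum>j<N. cis (2 * pi * (x - real j / real N)) ^ k / cis (2 * pi * (x - real j / real N)) ^ M) = 0"
proof -
  define r where "r = cis (2 * pi * ((real M - real k) / real N))"
  define z where "z = cis (2 * pi * x) ^ k / cis (2 * pi * x) ^ M"
  have "cis (2 * pi * (x - real j / real N)) ^ k / cis (2 * pi * (x - real j / real N)) ^ M = z * r ^ j" for j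
    unfolding r_def z_def Complex.DeMoivre cis_divide cis_mult using \<open>M < N\<close>
    by (intro arg_cong[of _ _ cis]) (simp add: field_simps)
  then have "(\<Sum>j<N. cis (2 * pi * (x - real j / real N)) ^ k / cis (2 * pi * (x - real j / real N)) ^ M)
      = z * (\<Sum>j<N. r ^ j)"
    by (simp add: sum_distrib_left)
  moreover have "r ^ N = 1"
  proof -
    have "r ^ N = cis (2 * pi * of_int (int M - int k))"
      unfolding r_def Complex.DeMoivre using \<open>M < N\<close> by (intro arg_cong[of _ _ cis]) simp
    then show ?thesis by (simp only: cis_multiple_2pi Ints_of_int)
  qed
  moreover have "r \<noteq> 1"
  proof
    assume "r = 1"
    then have "cos (2 * pi * ((real M - real k) / real N)) = 1"
      unfolding r_def by (metis cis.simps(1) one_complex.simps(1))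
    then obtain n :: int where "2 * pi * ((real M - real k) / real N) = n * 2 * pi"
      unfolding cos_one_2pi_int by auto
    then have "2 * pi * ((real M - real k) / real N) = 2 * pi * n" by (simp only: mult_ac)
    then have "(real M - real k) / real N = n" using pi_neq_zero by (metis mult_cancel_left mult_eq_0_iff zero_neq_numeral)
    then have "real M - real k = n * real N" using \<open>M < N\<close> by (simp add: field_simps)
    then have eq: "int M - int k = n * int N"
      by (metis (mono_tags, lifting) of_int_diff of_int_eq_iff of_int_mult of_int_of_nat_eq)
    have "n \<noteq> 0" using eq assms by auto
    then have "1 \<le> \<bar>n\<bar>" by linarith
    then have "int N \<le> \<bar>n * int N\<bar>" by (simp add: abs_mult mult_le_cancel_right1)
    then show False using eq assms by linarith
  qed
  ultimately show ?thesis by (simp add: sum_gp_strict)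
qed

text \<open>The mean of \<open>(1 + cos t) ^ M\<close> over a period, that is, its constant Fourier
  coefficient.\<close>

definition mean_weight :: "nat \<Rightarrow> real" where
  "mean_weight M = real ((2 * M) choose M) / 2 ^ M"

lemma mean_weight_pos: "mean_weight M > 0"
  by (simp add: mean_weight_def)

text \<open>Since \<open>2 - (1 + cos t) = 1 - cos t\<close>, the left side is the mean of
  \<open>(1 + cos t) ^ M * (1 - cos t)\<close>. Its decay relative to \<open>mean_weight M\<close>
  expresses the concentration of the kernel at 0; it comes from the ratio of consecutive central
  binomial coefficients.\<close>

lemma mean_weight_Suc: "2 * mean_weight M - mean_weight (Suc M) = mean_weight M / (real M + 1)"
proof -
  have "real (Suc M) * real ((2 * Suc M) choose Suc M) = 2 * (2 * real M + 1) * real ((2 * M) choose M)"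
  proof -
    let ?C = "real ((2 * M) choose M)" and ?D = "real ((2 * Suc M) choose Suc M)"
    have "fact M * fact M * ((2 * M) choose M) = (fact (2 * M) :: nat)"
      using binomial_fact_lemma[of M "2 * M"] by simp
    then have C: "fact M * fact M * ?C = fact (2 * M)"
      by (metis of_nat_fact of_nat_mult)
    have "fact (Suc M) * fact (Suc M) * ((2 * Suc M) choose Suc M) = (fact (2 * Suc M) :: nat)"
      using binomial_fact_lemma[of "Suc M" "2 * Suc M"] by (simp del: binomial_Suc_Suc fact_Suc)
    then have "fact (Suc M) * fact (Suc M) * ?D = fact (2 * Suc M)"
      by (metis of_nat_fact of_nat_mult)
    also have "\<dots> = 2 * (real M + 1) * (2 * real M + 1) * fact (2 * M)"
      by (simp add: algebra_simps)
    finally have "(real M + 1) * (fact M * fact M) * (real (Suc M) * ?D)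
        = (real M + 1) * (fact M * fact M) * (2 * (2 * real M + 1) * ?C)"
      unfolding C[symmetric] by (simp add: mult_ac add.commute del: binomial_Suc_Suc) (simp add: algebra_simps)
    then show ?thesis by (simp del: binomial_Suc_Suc of_nat_Suc)
  qed
  then have D: "real ((2 * Suc M) choose Suc M) = 2 * (2 * real M + 1) * real ((2 * M) choose M) / (real M + 1)"
    by (simp add: field_simps del: binomial_Suc_Suc)
  have "2 * (C / p) - 2 * (2 * m + 1) * C / (m + 1) / (2 * p) = C / p / (m + 1)"
    if "m \<ge> 0" "p > 0" for C m p :: real
    using that by (simp add: divide_simps) (simp add: algebra_simps)
  then show ?thesis
    unfolding mean_weight_def power_Suc D by simp
qed

text \<open>With \<open>z = exp (i t)\<close> one has \<open>1 + cos t = (1 + z)^2 / (2 z)\<close>; expanding the power, only the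
  constant Fourier coefficient survives the sum over the \<open>N\<close> equidistant nodes.\<close>

lemma sum_one_plus_cos_power:
  assumes "M < N"
  shows "(\<Sum>j<N. (1 + cos (2 * pi * (x - real j / real N))) ^ M) = real N * mean_weight M"
proof -
  define z where "z j = cis (2 * pi * (x - real j / real N))" for j
  have expand: "complex_of_real ((1 + cos (2 * pi * (x - real j / real N))) ^ M)
      = (\<Sum>k\<le>2 * M. of_nat ((2 * M) choose k) / 2 ^ M * (z j ^ k / z j ^ M))" for j
  proof -
    have "z j \<noteq> 0" by (simp add: z_def)
    have "complex_of_real (1 + cos (2 * pi * (x - real j / real N))) = 1 + (z j + inverse (z j)) / 2"
      unfolding z_def cis_inverse by (simp add: complex_eq_iff)
    also have "\<dots> = (1 + z j)\<^sup>2 / (2 * z j)"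
      using \<open>z j \<noteq> 0\<close> by (simp add: field_simps power2_eq_square)
    finally have "complex_of_real ((1 + cos (2 * pi * (x - real j / real N))) ^ M)
        = (z j + 1) ^ (2 * M) / (2 * z j) ^ M"
      by (simp add: power_divide power_mult add.commute)
    also have "(z j + 1) ^ (2 * M) = (\<Sum>k\<le>2 * M. of_nat ((2 * M) choose k) * z j ^ k)"
      by (subst binomial_ring) simp
    finally show ?thesis
      by (simp add: sum_divide_distrib power_mult_distrib)
  qed
  have "complex_of_real (\<Sum>j<N. (1 + cos (2 * pi * (x - real j / real N))) ^ M)
      = (\<Sum>j<N. \<Sum>k\<le>2 * M. of_nat ((2 * M) choose k) / 2 ^ M * (z j ^ k / z j ^ M))"
    by (simp only: of_real_sum expand)
  also have "\<dots> = (\<Sum>k\<le>2 * M. of_nat ((2 * M) choose k) / 2 ^ M * (\<Sum>j<N. z j ^ k / z j ^ M))"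
    by (subst sum.swap) (simp add: sum_distrib_left)
  also have "\<dots> = (\<Sum>k\<le>2 * M. if k = M then of_nat ((2 * M) choose k) / 2 ^ M * of_nat N else 0)"
  proof (rule sum.cong)
    fix k assume "k \<in> {..2 * M}"
    then have "k \<noteq> M \<Longrightarrow> (\<Sum>j<N. z j ^ k / z j ^ M) = 0"
      using sum_cis_shifted[OF assms, of k x] by (simp add: z_def)
    moreover have "(\<Sum>j<N. z j ^ M / z j ^ M) = of_nat N"
      by (simp add: z_def)
    ultimately show "of_nat ((2 * M) choose k) / 2 ^ M * (\<Sum>j<N. z j ^ k / z j ^ M)
        = (if k = M then of_nat ((2 * M) choose k) / 2 ^ M * of_nat N else 0)"
      by auto
  qed simp
  also have "\<dots> = complex_of_real (real N * mean_weight M)"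
    by (simp add: mean_weight_def)
  finally show ?thesis by (simp only: of_real_eq_iff)
qed

lemma sum_grid_prod:
  fixes f :: "'d::finite \<Rightarrow> nat \<Rightarrow> real"
  shows "(\<Sum>i\<in>grid_idx N. \<Prod>k\<in>UNIV. f k (i $ k)) = (\<Prod>k\<in>UNIV. \<Sum>j<N. f k j)"
proof -
  have "bij_betw vec_nth (grid_idx N :: (nat^'d) set) (UNIV \<rightarrow>\<^sub>E {..<N})"
    by (rule bij_betwI[of _ _ _ vec_lambda]) (auto simp: grid_idx_def PiE_iff)
  then have "(\<Sum>i\<in>grid_idx N. \<Prod>k\<in>UNIV. f k (i $ k)) = (\<Sum>g\<in>UNIV \<rightarrow>\<^sub>E {..<N}. \<Prod>k\<in>UNIV. f k (g k))"
    by (rule sum.reindex_bij_betw)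
  then show ?thesis by (simp add: prod_sum_PiE)
qed

text \<open>The de la Vallee Poussin kernel, proportional to \<open>cos (pi * t) ^ (2 * M)\<close>
  and normalized to mean 1. It is nonnegative, concentrates at the integers as \<open>M\<close>
  grows, and is a trigonometric polynomial of degree \<open>M\<close>.\<close>

definition mollifier1 :: "nat \<Rightarrow> real \<Rightarrow> real" where
  "mollifier1 M t = (1 + cos (2 * pi * t)) ^ M / mean_weight M"

definition mollifier1_deriv :: "nat \<Rightarrow> real \<Rightarrow> real" where
  "mollifier1_deriv M t = - (real M * (1 + cos (2 * pi * t)) ^ (M - 1) * (2 * pi * sin (2 * pi * t))) / mean_weight M"

definition mollifier :: "nat \<Rightarrow> real^'d::finite \<Rightarrow> real" where
  "mollifier M y = (\<Prod>k\<in>UNIV. mollifier1 M (y $ k))"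

definition mollifier_grad :: "nat \<Rightarrow> real^'d::finite \<Rightarrow> real^'d" where
  "mollifier_grad M y = (\<chi> k. mollifier1_deriv M (y $ k) * (\<Prod>k'\<in>UNIV - {k}. mollifier1 M (y $ k')))"

lemma mollifier1_nonneg: "mollifier1 M t \<ge> 0"
proof -
  have "0 \<le> 1 + cos (2 * pi * t)" using cos_ge_minus_one[of "2 * pi * t"] by linarith
  then show ?thesis by (simp add: mollifier1_def less_imp_le[OF mean_weight_pos])
qed

lemma mollifier_nonneg: "mollifier M y \<ge> 0"
  by (simp add: mollifier_def mollifier1_nonneg prod_nonneg)

lemma cos_sin_add_int:
  "cos (2 * pi * (t + real_of_int n)) = cos (2 * pi * t)"
  "sin (2 * pi * (t + real_of_int n)) = sin (2 * pi * t)"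
  by (simp_all add: distrib_left cos_add sin_add)

lemma mollifier_periodic: "mollifier M (y + zvec l) = mollifier M y"
  by (simp add: mollifier_def mollifier1_def zvec_def cos_sin_add_int)

lemma mollifier_grad_periodic: "mollifier_grad M (y + zvec l) = mollifier_grad M y"
  by (simp add: mollifier_grad_def mollifier1_def mollifier1_deriv_def zvec_def cos_sin_add_int)

lemma mollifier1_DERIV: "(mollifier1 M has_real_derivative mollifier1_deriv M t) (at t)"
  unfolding mollifier1_def[abs_def] mollifier1_deriv_def
  by (intro DERIV_cdivide) (rule derivative_eq_intros refl | simp)+

lemma mollifier_GDERIV: "GDERIV (mollifier M) y :> mollifier_grad M y"
proof -
  have "((\<lambda>y. mollifier1 M (y $ k)) has_derivative (\<lambda>h. mollifier1_deriv M (y $ k) * h $ k)) (at y)" for k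
    using has_derivative_compose[of "\<lambda>y. y $ k" "\<lambda>h. h $ k" y UNIV "mollifier1 M"]
      bounded_linear_imp_has_derivative[OF bounded_linear_vec_nth]
      mollifier1_DERIV[unfolded has_field_derivative_def] by blast
  then have "(mollifier M has_derivative (\<lambda>h. \<Sum>k\<in>UNIV. mollifier1_deriv M (y $ k) * h $ k *
      (\<Prod>k'\<in>UNIV - {k}. mollifier1 M (y $ k')))) (at y)"
    unfolding mollifier_def[abs_def] by (intro has_derivative_prod)
  then show ?thesis
    by (simp add: gderiv_def inner_vec_def mollifier_grad_def mult_ac)
qed

lemma continuous_mollifier_grad: "continuous_on UNIV (mollifier_grad M)"
  unfolding mollifier_grad_def mollifier1_def mollifier1_deriv_def
  by (intro continuous_intros) (use mean_weight_pos[of M] in auto)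

lemma sum_mollifier1:
  assumes "M < N"
  shows "(\<Sum>j<N. mollifier1 M (x - real j / real N)) = real N"
  using sum_one_plus_cos_power[OF assms, of x] mean_weight_pos[of M]
  by (simp add: mollifier1_def flip: sum_divide_distrib)

text \<open>Writing \<open>1 - cos\<close> as \<open>2 - (1 + cos)\<close> reduces this to two
  consecutive powers. The extra factor raises the degree to \<open>M + 1\<close>, hence the stronger
  assumption on \<open>N\<close>.\<close>

lemma sum_mollifier1_dist:
  assumes "Suc M < N"
  shows "(\<Sum>j<N. mollifier1 M (x - real j / real N) * (1 - cos (2 * pi * (x - real j / real N))))
    = real N / (real M + 1)"
proof -
  let ?c = "\<lambda>j. 1 + cos (2 * pi * (x - real j / real N))"
  have "mollifier1 M (x - real j / real N) * (1 - cos (2 * pi * (x - real j / real N)))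
      = (2 * ?c j ^ M - ?c j ^ Suc M) / mean_weight M" for j
    by (simp add: mollifier1_def diff_divide_distrib algebra_simps)
  then have "(\<Sum>j<N. mollifier1 M (x - real j / real N) * (1 - cos (2 * pi * (x - real j / real N))))
      = (2 * (\<Sum>j<N. ?c j ^ M) - (\<Sum>j<N. ?c j ^ Suc M)) / mean_weight M"
    by (simp only: sum_divide_distrib[symmetric] sum_subtractf sum_distrib_left)
  also have "\<dots> = real N * (2 * mean_weight M - mean_weight (Suc M)) / mean_weight M"
    using assms by (simp only: sum_one_plus_cos_power[of _ N] Suc_lessD) (simp add: algebra_simps)
  also have "\<dots> = real N / (real M + 1)"
    unfolding mean_weight_Suc using mean_weight_pos[of M] by simp
  finally show ?thesis .
qed

lemma sum_mollifier:
  fixes y :: "real^'d::finite"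
  assumes "M < N"
  shows "(\<Sum>i\<in>grid_idx N. mollifier M (y - grid_point N i)) = real N ^ CARD('d)"
proof -
  have "(\<Sum>i\<in>grid_idx N. mollifier M (y - grid_point N i))
      = (\<Sum>i\<in>grid_idx N. \<Prod>k\<in>UNIV. (\<lambda>k j. mollifier1 M (y $ k - real j / real N)) k (i $ k))"
    by (simp add: mollifier_def grid_point_def)
  also have "\<dots> = (\<Prod>k\<in>(UNIV :: 'd set). \<Sum>j<N. mollifier1 M (y $ k - real j / real N))"
    by (rule sum_grid_prod)
  finally show ?thesis by (simp add: sum_mollifier1[OF assms])
qed

lemma sum_mollifier_dist:
  fixes y :: "real^'d::finite"
  assumes "Suc M < N"
  shows "(\<Sum>i\<in>grid_idx N. mollifier M (y - grid_point N i) * (1 - cos (2 * pi * (y $ k - grid_point N i $ k))))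
      = real N ^ CARD('d) / (real M + 1)"
proof -
  define f where "f = (\<lambda>k' j. mollifier1 M (y $ k' - real j / real N) *
      (if k' = k then 1 - cos (2 * pi * (y $ k' - real j / real N)) else 1))"
  have "(\<Sum>i\<in>grid_idx N. mollifier M (y - grid_point N i) * (1 - cos (2 * pi * (y $ k - grid_point N i $ k))))
      = (\<Sum>i\<in>grid_idx N. \<Prod>k'\<in>UNIV. f k' (i $ k'))"
    by (simp add: mollifier_def grid_point_def f_def prod.distrib)
  also have "\<dots> = (\<Prod>k'\<in>UNIV. \<Sum>j<N. f k' j)" by (rule sum_grid_prod)
  also have "\<dots> = (\<Prod>k'\<in>UNIV. real N * (if k' = k then 1 / (real M + 1) else 1))"
  proof (rule prod.cong)
    fix k'
    show "(\<Sum>j<N. f k' j) = real N * (if k' = k then 1 / (real M + 1) else 1)"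
      using sum_mollifier1_dist[OF assms, of "y $ k"] sum_mollifier1[OF Suc_lessD[OF assms], of "y $ k'"]
      by (simp add: f_def)
  qed simp
  also have "\<dots> = real N ^ CARD('d) / (real M + 1)"
    by (simp add: prod.distrib)
  finally show ?thesis .
qed

section \<open>Smoothing of discrete potentials\<close>

lemma periodic_factors:
  assumes "\<And>y l. f (y + zvec l) = f y"
  shows "f (rep_torus (to_torus y)) = f y"
proof -
  obtain l where "y = rep_torus (to_torus y) + zvec l"
    by (metis to_torus_eq_iff to_torus_rep)
  then show ?thesis using assms by metis
qed

lemma periodic_bounded:
  fixes f :: "real^'d::finite \<Rightarrow> 'b::real_normed_vector"
  assumes cont: "continuous_on UNIV f" and per: "\<And>y l. f (y + zvec l) = f y"
  obtains B where "B > 0" "\<And>y. norm (f y) \<le> B"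
proof -
  have "compact (f ` cbox 0 1)"
    by (intro compact_continuous_image continuous_on_subset[OF cont]) auto
  then obtain B where B: "B > 0" "\<forall>r\<in>f ` cbox 0 1. norm r \<le> B"
    using compact_imp_bounded bounded_pos by metis
  have "norm (f y) \<le> B" for y
    using B(2) per unit_cube_representative[of y] by (metis image_eqI)
  then show ?thesis using B(1) that by blast
qed

lemma GDERIV_mean_value:
  fixes f :: "'a::real_inner \<Rightarrow> real"
  assumes "\<And>y. GDERIV f y :> G y"
  obtains t where "0 < t" "t < 1" "f (y + h) - f y = G (y + t *\<^sub>R h) \<bullet> h"
proof -
  have "((\<lambda>t. f (y + t *\<^sub>R h)) has_real_derivative G (y + t *\<^sub>R h) \<bullet> h) (at t)" for t
    unfolding has_field_derivative_def
    by (rule has_derivative_eq_rhs[OF has_derivative_compose[of "\<lambda>t. y + t *\<^sub>R h" "\<lambda>s. s *\<^sub>R h" _ _ f]])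
       (use assms in \<open>auto simp: gderiv_def inner_commute fun_eq_iff intro!: derivative_eq_intros\<close>)
  then obtain t where "0 < t" "t < 1" "f (y + 1 *\<^sub>R h) - f (y + 0 *\<^sub>R h) = (1 - 0) * (G (y + t *\<^sub>R h) \<bullet> h)"
    using MVT2[of 0 1 "\<lambda>t. f (y + t *\<^sub>R h)" "\<lambda>t. G (y + t *\<^sub>R h) \<bullet> h"] by auto
  then show ?thesis by (intro that[of t]) auto
qed

lemma GDERIV_lipschitz:
  fixes f :: "'a::real_inner \<Rightarrow> real"
  assumes "\<And>y. GDERIV f y :> G y" and "\<And>y. norm (G y) \<le> B"
  shows "\<bar>f (y + h) - f y\<bar> \<le> B * norm h"
proof -
  obtain t where "f (y + h) - f y = G (y + t *\<^sub>R h) \<bullet> h"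
    using GDERIV_mean_value[OF assms(1)] by metis
  then have "\<bar>f (y + h) - f y\<bar> \<le> norm (G (y + t *\<^sub>R h)) * norm h"
    using Cauchy_Schwarz_ineq2 by metis
  also have "\<dots> \<le> B * norm h" using assms(2) by (intro mult_right_mono) auto
  finally show ?thesis .
qed

text \<open>By the mean value theorem the remainder is an increment of \<open>G\<close> paired with
  \<open>h\<close>, and a continuous periodic gradient is uniformly continuous.\<close>

lemma periodic_GDERIV_remainder:
  fixes f :: "real^'d::finite \<Rightarrow> real"
  assumes deriv: "\<And>y. GDERIV f y :> G y" and cont: "continuous_on UNIV G"
    and per: "\<And>y l. G (y + zvec l) = G y" and "\<rho> > 0"
  obtains \<delta> where "\<delta> > 0" "\<And>y h. norm h \<le> \<delta> \<Longrightarrow> \<bar>f (y + h) - f y - G y \<bullet> h\<bar> \<le> \<rho> * norm h"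
proof -
  obtain \<delta> where \<delta>: "\<delta> > 0" "\<And>y y'. dist y' y < \<delta> \<Longrightarrow> dist (G y') (G y) < \<rho>"
    using periodic_uniformly_continuous1[OF cont per] \<open>\<rho> > 0\<close>
    unfolding uniformly_continuous_on_def by blast
  show ?thesis
  proof (rule that[of "\<delta> / 2"])
    fix y h :: "real^'d" assume h: "norm h \<le> \<delta> / 2"
    obtain t where t: "0 < t" "t < 1" "f (y + h) - f y = G (y + t *\<^sub>R h) \<bullet> h"
      using GDERIV_mean_value[OF deriv] by metis
    have "norm (t *\<^sub>R h) \<le> 1 * norm h"
      using t unfolding norm_scaleR by (intro mult_right_mono) auto
    then have "dist (y + t *\<^sub>R h) y < \<delta>" using h \<delta>(1) by (simp add: dist_norm)
    then have "norm (G (y + t *\<^sub>R h) - G y) \<le> \<rho>"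
      using \<delta>(2) by (metis dist_norm less_imp_le)
    then have "norm (G (y + t *\<^sub>R h) - G y) * norm h \<le> \<rho> * norm h"
      by (intro mult_right_mono) auto
    moreover have "f (y + h) - f y - G y \<bullet> h = (G (y + t *\<^sub>R h) - G y) \<bullet> h"
      using t by (simp add: inner_diff_left)
    ultimately show "\<bar>f (y + h) - f y - G y \<bullet> h\<bar> \<le> \<rho> * norm h"
      using Cauchy_Schwarz_ineq2 order_trans by metis
  qed (use \<delta> in auto)
qed

section \<open>Grid translations in integer coordinates\<close>

definition wrap :: "nat \<Rightarrow> int^'d \<Rightarrow> nat^'d::finite" where
  "wrap N z = (\<chi> k. nat (z $ k mod int N))"

text \<open>Shifts add in integer coordinates and are reduced modulo \<open>N\<close> only
  afterwards, by \<open>wrap\<close>.\<close>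

definition int_vec :: "nat^'d \<Rightarrow> int^'d::finite" where
  "int_vec i = (\<chi> k. int (i $ k))"

lemma wrap_in_grid: "N \<ge> 1 \<Longrightarrow> wrap N z \<in> grid_idx N"
  by (simp add: wrap_def grid_idx_def nat_less_iff)

lemma wrap_int_vec: "i \<in> grid_idx N \<Longrightarrow> wrap N (int_vec i) = i"
  by (simp add: wrap_def int_vec_def grid_idx_def vec_eq_iff nat_mod_distrib)

lemma grid_point_int_vec: "grid_point N i = (1 / real N) *\<^sub>R zvec (int_vec i)"
  by (simp add: grid_point_def zvec_def int_vec_def vec_eq_iff)

lemma grid_point_wrap:
  assumes "N \<ge> 1"
  shows "(1 / real N) *\<^sub>R zvec z = grid_point N (wrap N z) + zvec (\<chi> k. z $ k div int N)"
proof -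
  have "real_of_int (z $ k) = real (nat (z $ k mod int N)) + real N * real_of_int (z $ k div int N)" for k
  proof -
    have "z $ k = z $ k mod int N + int N * (z $ k div int N)"
      by simp
    then have "real_of_int (z $ k) = real_of_int (z $ k mod int N) + real N * real_of_int (z $ k div int N)"
      by (metis of_int_add of_int_mult of_int_of_nat_eq)
    then show ?thesis using assms by simp
  qed
  then show ?thesis
    using assms by (simp add: vec_eq_iff zvec_def grid_point_def wrap_def add_divide_distrib)
qed

lemma bij_betw_wrap_shift:
  assumes "N \<ge> 1"
  shows "bij_betw (\<lambda>i. wrap N (int_vec i + z)) (grid_idx N) (grid_idx N)"
proof (rule bij_betwI[of _ _ _ "\<lambda>i. wrap N (int_vec i - z)"])
  have "int (nat (w mod int N)) = w mod int N" for w
    using assms by simp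
  then have "wrap N (int_vec (wrap N (w + z)) - z) = wrap N w"
    "wrap N (int_vec (wrap N (w - z)) + z) = wrap N w" for w
    by (simp_all add: wrap_def int_vec_def vec_eq_iff mod_simps)
  then show "wrap N (int_vec (wrap N (int_vec i + z)) - z) = i"
    "wrap N (int_vec (wrap N (int_vec i - z)) + z) = i" if "i \<in> grid_idx N" for i
    using that by (simp_all add: wrap_int_vec)
qed (use assms in \<open>auto intro: wrap_in_grid\<close>)

text \<open>Feasibility for the dual linear program. The increment is compared with
  \<open>L - m\<close> per step and not per unit time, so it is \<open>\<tau> * u\<close> that
  approximates a subsolution.\<close>

definition grid_potential ::
  "('d::finite torus \<Rightarrow> real^'d \<Rightarrow> real) \<Rightarrow> nat \<Rightarrow> real \<Rightarrow> real \<Rightarrow> (nat^'d \<Rightarrow> real) \<Rightarrow> bool" where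
  "grid_potential L N \<tau> m u \<longleftrightarrow> (\<forall>i\<in>grid_idx N. \<forall>j\<in>grid_idx N. \<forall>l.
     u j - u i \<le> L (to_torus (grid_point N i)) (velocity N \<tau> i j l) - m)"

text \<open>In integer coordinates an edge is a displacement \<open>z\<close>. Its winding vector is
  the difference of the integer parts that \<open>wrap\<close> discards at the two ends.\<close>

lemma potential_shift:
  fixes u :: "nat^'d::finite \<Rightarrow> real" and L :: "'d torus \<Rightarrow> real^'d \<Rightarrow> real"
  assumes u: "grid_potential L N \<tau> m u"
    and "N \<ge> 1"
  shows "u (wrap N (a + z)) - u (wrap N a)
    \<le> L (to_torus (grid_point N (wrap N a))) ((1 / (\<tau> * real N)) *\<^sub>R zvec z) - m"
proof -
  define l :: "int^'d" where "l = (\<chi> k. (a + z) $ k div int N) - (\<chi> k. a $ k div int N)"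
  have "grid_point N (wrap N (a + z)) + zvec l - grid_point N (wrap N a) = (1 / real N) *\<^sub>R zvec z"
    using grid_point_wrap[OF \<open>N \<ge> 1\<close>, of "a + z"] grid_point_wrap[OF \<open>N \<ge> 1\<close>, of a]
    unfolding l_def zvec_add diff_conv_add_uminus zvec_uminus scaleR_add_right
    by (simp add: algebra_simps)
  then have "velocity N \<tau> (wrap N a) (wrap N (a + z)) l = (1 / (\<tau> * real N)) *\<^sub>R zvec z"
    by (simp add: velocity_def zvec_def)
  then show ?thesis
    using u wrap_in_grid[OF \<open>N \<ge> 1\<close>] unfolding grid_potential_def by metis
qed

lemma norm_le_card:
  fixes v :: "real^'d::finite"
  assumes "\<And>k. \<bar>v $ k\<bar> \<le> b"
  shows "norm v \<le> real CARD('d) * b"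
  using norm_le_l1_cart[of v] sum_bounded_above[of UNIV "\<lambda>k. \<bar>v $ k\<bar>" b] assms by force

text \<open>The two grid points are joined by a chain of about \<open>1 / \<tau>\<close> steps of bounded velocity.\<close>

lemma potential_oscillation:
  fixes u :: "nat^'d::finite \<Rightarrow> real" and L :: "'d torus \<Rightarrow> real^'d \<Rightarrow> real"
  assumes u: "grid_potential L N \<tau> m u"
    and "N \<ge> 1" "\<tau> > 0" "\<tau> \<le> 1" "1 / real N \<le> \<tau>"
    and B: "\<And>x v. norm v \<le> 2 * real CARD('d) \<Longrightarrow> L x v \<le> B"
    and i: "i \<in> grid_idx N" and j: "j \<in> grid_idx N"
  shows "\<tau> * (u j - u i) \<le> 2 * (B - m)"
proof -
  \<comment> \<open>The number of steps: at least \<open>1 / \<tau>\<close> to keep the speed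
    bounded, and with \<open>\<tau> * M \<le> 2\<close> to keep the total cost bounded.\<close>
  define M where "M = nat \<lceil>1 / \<tau>\<rceil>"
  have M: "real M \<ge> 1 / \<tau>" "real M \<le> 1 / \<tau> + 1"
    using \<open>\<tau> > 0\<close> unfolding M_def by (simp_all add: of_nat_ceiling)
  have "M > 0" using M(1) \<open>\<tau> > 0\<close> by (simp add: M_def)
  define D where "D k = real (j $ k) - real (i $ k)" for k
  \<comment> \<open>The straight segment from \<open>i\<close> to \<open>j\<close>, rounded down to
    integer coordinates.\<close>
  define p :: "nat \<Rightarrow> int^'d" where "p s = int_vec i + (\<chi> k. \<lfloor>real s * D k / real M\<rfloor>)" for s
  \<comment> \<open>Per coordinate the slope contributes at most 1 to the velocity, and so does
    rounding, which moves the displacement by at most one mesh width; this uses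
    \<open>1 / N \<le> \<tau>\<close>.\<close>
  have step: "u (wrap N (p (Suc s))) - u (wrap N (p s)) \<le> B - m" for s
  proof -
    define z where "z = p (Suc s) - p s"
    have "\<bar>((1 / (\<tau> * real N)) *\<^sub>R zvec z) $ k\<bar> \<le> 2" for k
    proof -
      have Dk: "\<bar>D k\<bar> \<le> real N"
        using i j by (auto simp: D_def grid_idx_def abs_if) (smt (verit) of_nat_0_le_iff of_nat_less_iff)+
      have "real (Suc s) * D k / real M = real s * D k / real M + D k / real M"
        by (simp add: add_divide_distrib distrib_right)
      moreover have "real_of_int (z $ k) = real_of_int \<lfloor>real (Suc s) * D k / real M\<rfloor> - real_of_int \<lfloor>real s * D k / real M\<rfloor>"
        by (simp add: z_def p_def)
      ultimately have "\<bar>real_of_int (z $ k)\<bar> \<le> \<bar>D k / real M\<bar> + 1" by linarith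
      also have "\<dots> = \<bar>D k\<bar> / real M + 1" by simp
      also have "\<dots> \<le> real N * \<tau> + 1"
      proof -
        have "\<bar>D k\<bar> / real M \<le> real N / (1 / \<tau>)"
          using M(1) Dk \<open>\<tau> > 0\<close> by (intro frac_le) auto
        then show ?thesis by simp
      qed
      also have "1 \<le> real N * \<tau>" using assms by (simp add: field_simps)
      finally have "\<bar>real_of_int (z $ k)\<bar> \<le> 2 * (\<tau> * real N)" by (simp add: mult.commute)
      then show ?thesis using assms by (simp add: zvec_def abs_mult divide_simps)
    qed
    then have "norm ((1 / (\<tau> * real N)) *\<^sub>R zvec z) \<le> 2 * real CARD('d)"
      using norm_le_card by (metis mult.commute)
    then have "L (to_torus (grid_point N (wrap N (p s)))) ((1 / (\<tau> * real N)) *\<^sub>R zvec z) \<le> B"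
      by (rule B)
    then show ?thesis
      using potential_shift[OF u \<open>N \<ge> 1\<close>, of "p s" z] by (simp add: z_def)
  qed
  have "u (wrap N (p s)) - u (wrap N (p 0)) \<le> real s * (B - m)" for s
  proof (induction s)
    case (Suc s)
    then show ?case using step[of s] by (simp add: algebra_simps)
  qed simp
  moreover have "\<lfloor>real a - real b\<rfloor> = int a - int b" for a b :: nat
    by linarith
  then have "p 0 = int_vec i" "p M = int_vec j"
    using \<open>M > 0\<close> by (auto simp: p_def D_def int_vec_def vec_eq_iff)
  ultimately have "u j - u i \<le> real M * (B - m)"
    using wrap_int_vec i j by metis
  then have "\<tau> * (u j - u i) \<le> \<tau> * real M * (B - m)"
    using \<open>\<tau> > 0\<close> by (simp add: mult.assoc)
  also have "\<dots> \<le> 2 * (B - m)"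
  proof (rule mult_right_mono)
    have "\<tau> * real M \<le> \<tau> * (1 / \<tau> + 1)" using M \<open>\<tau> > 0\<close> by (intro mult_left_mono) auto
    also have "\<dots> \<le> 2" using \<open>\<tau> > 0\<close> \<open>\<tau> \<le> 1\<close> by (simp add: distrib_left)
    finally show "\<tau> * real M \<le> 2" .
    \<comment> \<open>The potential inequality for the zero displacement; it makes
      \<open>B - m\<close> nonnegative, so that \<open>\<tau> * M\<close> may be replaced by
      2.\<close>
    have "m \<le> L (to_torus (grid_point N (wrap N (0 :: int^'d)))) 0"
      using potential_shift[OF u \<open>N \<ge> 1\<close>, of 0 0] by (simp add: zvec_def zero_vec_def[symmetric])
    then show "0 \<le> B - m" using B[of 0] by (smt (verit) norm_zero of_nat_0_le_iff)
  qed
  finally show ?thesis .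
qed

section \<open>Convolution with the kernel over the grid\<close>

definition smoothing :: "nat \<Rightarrow> nat \<Rightarrow> (nat^'d \<Rightarrow> real) \<Rightarrow> real^'d::finite \<Rightarrow> real" where
  "smoothing M N U y = (\<Sum>i\<in>grid_idx N. U i * mollifier M (y - grid_point N i)) / real N ^ CARD('d)"

definition smoothing_grad :: "nat \<Rightarrow> nat \<Rightarrow> (nat^'d \<Rightarrow> real) \<Rightarrow> real^'d::finite \<Rightarrow> real^'d" where
  "smoothing_grad M N U y =
     (1 / real N ^ CARD('d)) *\<^sub>R (\<Sum>i\<in>grid_idx N. U i *\<^sub>R mollifier_grad M (y - grid_point N i))"

lemma card_grid_idx: "real (card (grid_idx N :: (nat^'d::finite) set)) = real N ^ CARD('d)"
  using sum_grid_prod[of "\<lambda>(_ :: 'd) _. 1 :: real" N] by simp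

lemma smoothing_periodic: "smoothing M N U (y + zvec l) = smoothing M N U y"
proof -
  have "mollifier M (y + zvec l - grid_point N i) = mollifier M (y - grid_point N i)" for i
    using mollifier_periodic[of M "y - grid_point N i" l] by (simp add: algebra_simps)
  then show ?thesis by (simp add: smoothing_def)
qed

lemma smoothing_grad_periodic: "smoothing_grad M N U (y + zvec l) = smoothing_grad M N U y"
proof -
  have "mollifier_grad M (y + zvec l - grid_point N i) = mollifier_grad M (y - grid_point N i)" for i
    using mollifier_grad_periodic[of M "y - grid_point N i" l] by (simp add: algebra_simps)
  then show ?thesis by (simp add: smoothing_grad_def)
qed

lemma continuous_smoothing_grad: "continuous_on UNIV (smoothing_grad M N U)"
  unfolding smoothing_grad_def
  by (intro continuous_intros continuous_on_compose2[OF continuous_mollifier_grad]) auto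

lemma smoothing_GDERIV: "GDERIV (smoothing M N U) y :> smoothing_grad M N U y"
proof -
  have "((\<lambda>y. mollifier M (y - grid_point N i)) has_derivative
      (\<lambda>h. h \<bullet> mollifier_grad M (y - grid_point N i))) (at y)" for i
  proof -
    have "((\<lambda>y. y - grid_point N i) has_derivative (\<lambda>h. h)) (at y)"
      by (auto intro!: derivative_eq_intros)
    then show ?thesis
      by (rule has_derivative_compose[OF _ mollifier_GDERIV[unfolded gderiv_def]])
  qed
  then show ?thesis
    unfolding gderiv_def smoothing_def[abs_def] smoothing_grad_def
    by (auto intro!: derivative_eq_intros
        simp: inner_sum_right sum_divide_distrib sum_distrib_left divide_inverse mult_ac)
qed

lemma average_bound:
  fixes f :: "nat^'d::finite \<Rightarrow> real"
  assumes "N \<ge> 1" and "\<And>i. i \<in> grid_idx N \<Longrightarrow> \<bar>f i\<bar> \<le> b"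
  shows "\<bar>(\<Sum>i\<in>grid_idx N. f i) / real N ^ CARD('d)\<bar> \<le> b"
proof -
  have "\<bar>\<Sum>i\<in>grid_idx N. f i\<bar> \<le> (\<Sum>i\<in>(grid_idx N :: (nat^'d) set). b)"
    using assms(2) by (intro order_trans[OF sum_abs] sum_mono)
  also have "\<dots> = real N ^ CARD('d) * b" by (simp add: card_grid_idx)
  finally show ?thesis using assms(1) by (simp add: field_simps)
qed

lemma smoothing_grad_bound:
  fixes U :: "nat^'d::finite \<Rightarrow> real"
  assumes "N \<ge> 1" and U: "\<And>i. i \<in> grid_idx N \<Longrightarrow> \<bar>U i\<bar> \<le> D"
    and B: "\<And>y :: real^'d. norm (mollifier_grad M y) \<le> B"
  shows "norm (smoothing_grad M N U y) \<le> D * B"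
proof -
  have "norm (smoothing_grad M N U y) \<le>
      (\<Sum>i\<in>grid_idx N. norm (U i *\<^sub>R mollifier_grad M (y - grid_point N i))) / real N ^ CARD('d)"
    unfolding smoothing_grad_def by (simp add: divide_right_mono sum_norm_le)
  also have "\<dots> \<le> D * B"
  proof (rule abs_le_D1[OF average_bound[OF \<open>N \<ge> 1\<close>]])
    fix i :: "nat^'d" assume "i \<in> grid_idx N"
    then show "\<bar>norm (U i *\<^sub>R mollifier_grad M (y - grid_point N i))\<bar> \<le> D * B"
      using U[of i] B[of "y - grid_point N i"] by (auto intro!: mult_mono)
  qed
  finally show ?thesis .
qed

text \<open>All regularity is that of the kernel, multiplied by the supremum of
  \<open>\<bar>U\<bar>\<close>; the estimate is therefore uniform in \<open>N\<close>.\<close>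

lemma smoothing_remainder:
  fixes U :: "nat^'d::finite \<Rightarrow> real"
  assumes "N \<ge> 1" and U: "\<And>i. i \<in> grid_idx N \<Longrightarrow> \<bar>U i\<bar> \<le> D"
    and \<rho>: "\<And>y :: real^'d. \<bar>mollifier M (y + h) - mollifier M y - mollifier_grad M y \<bullet> h\<bar> \<le> \<rho>"
  shows "\<bar>smoothing M N U (y + h) - smoothing M N U y - smoothing_grad M N U y \<bullet> h\<bar> \<le> D * \<rho>"
proof -
  have shift: "y + h - grid_point N i = y - grid_point N i + h" for i by simp
  have "smoothing M N U (y + h) - smoothing M N U y - smoothing_grad M N U y \<bullet> h
      = (\<Sum>i\<in>grid_idx N. U i * (mollifier M (y - grid_point N i + h) - mollifier M (y - grid_point N i)
          - mollifier_grad M (y - grid_point N i) \<bullet> h)) / real N ^ CARD('d)"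
    unfolding smoothing_def smoothing_grad_def
    by (simp add: inner_sum_left right_diff_distrib sum_subtractf diff_divide_distrib shift)
  also have "\<bar>\<dots>\<bar> \<le> D * \<rho>"
  proof (rule average_bound[OF \<open>N \<ge> 1\<close>])
    fix i :: "nat^'d" assume "i \<in> grid_idx N"
    then show "\<bar>U i * (mollifier M (y - grid_point N i + h) - mollifier M (y - grid_point N i)
          - mollifier_grad M (y - grid_point N i) \<bullet> h)\<bar> \<le> D * \<rho>"
      unfolding abs_mult using U[of i] \<rho>[of "y - grid_point N i"] by (intro mult_mono) auto
  qed
  finally show ?thesis .
qed

text \<open>Translating the argument by a grid vector permutes the nodes, so the shift passes to the
  potential. This holds at every real \<open>y\<close>, which is how grid inequalities reach points
  off the grid.\<close>

lemma smoothing_grid_shift: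
  fixes U :: "nat^'d::finite \<Rightarrow> real"
  assumes "N \<ge> 1"
  shows "smoothing M N U (y + (1 / real N) *\<^sub>R zvec z) =
    (\<Sum>i\<in>grid_idx N. U (wrap N (int_vec i + z)) * mollifier M (y - grid_point N i)) / real N ^ CARD('d)"
proof -
  have "mollifier M (y + (1 / real N) *\<^sub>R zvec z - grid_point N (wrap N (int_vec i + z)))
      = mollifier M (y - grid_point N i)" for i
  proof -
    have "y + (1 / real N) *\<^sub>R zvec z - grid_point N (wrap N (int_vec i + z))
        = y - grid_point N i + zvec (\<chi> k. (int_vec i + z) $ k div int N)"
      using grid_point_wrap[OF assms, of "int_vec i + z"]
      by (simp add: grid_point_int_vec[of N i] zvec_add scaleR_add_right algebra_simps)
    then show ?thesis by (simp only: mollifier_periodic)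
  qed
  then have "(\<Sum>i\<in>grid_idx N. U (wrap N (int_vec i + z)) * mollifier M (y - grid_point N i))
      = (\<Sum>i\<in>grid_idx N. U (wrap N (int_vec i + z)) *
          mollifier M (y + (1 / real N) *\<^sub>R zvec z - grid_point N (wrap N (int_vec i + z))))"
    by simp
  also have "\<dots> = (\<Sum>i\<in>grid_idx N. U i * mollifier M (y + (1 / real N) *\<^sub>R zvec z - grid_point N i))"
    by (rule sum.reindex_bij_betw[OF bij_betw_wrap_shift[OF assms]])
  finally show ?thesis by (simp add: smoothing_def)
qed

text \<open>Average the potential inequality over all nodes with the kernel weights, which have mean
  1. Assumption \<open>F\<close> moves the base point of \<open>L\<close> from the node to
  \<open>y\<close> at a price whose kernel average is explicit. The constant \<open>c\<close>
  cancels; it serves to keep the smoothed function bounded.\<close>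

lemma smoothing_increment:
  fixes u :: "nat^'d::finite \<Rightarrow> real"
  assumes u: "grid_potential L N \<tau> m u" and "\<tau> > 0" and "Suc M < N"
    and F: "\<And>y'. L (to_torus y') ((1 / (\<tau> * real N)) *\<^sub>R zvec z)
      \<le> b + C * (\<Sum>k\<in>UNIV. 1 - cos (2 * pi * (y $ k - y' $ k)))"
  shows "smoothing M N (\<lambda>i. \<tau> * (u i - c)) (y + (1 / real N) *\<^sub>R zvec z)
      - smoothing M N (\<lambda>i. \<tau> * (u i - c)) y
    \<le> \<tau> * (b + C * real CARD('d) / (real M + 1) - m)"
proof -
  let ?K = "\<lambda>i. mollifier M (y - grid_point N i)"
  let ?d = "\<lambda>i. \<Sum>k\<in>UNIV. 1 - cos (2 * pi * (y $ k - grid_point N i $ k))"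
  have "N \<ge> 1" using assms by simp
  have "smoothing M N (\<lambda>i. \<tau> * (u i - c)) (y + (1 / real N) *\<^sub>R zvec z)
      - smoothing M N (\<lambda>i. \<tau> * (u i - c)) y
      = (\<Sum>i\<in>grid_idx N. \<tau> * (u (wrap N (int_vec i + z)) - u i) * ?K i) / real N ^ CARD('d)"
    unfolding smoothing_grid_shift[OF \<open>N \<ge> 1\<close>] unfolding smoothing_def
    by (simp add: diff_divide_distrib[symmetric] sum_subtractf[symmetric] algebra_simps)
  also have "\<dots> \<le> (\<Sum>i\<in>grid_idx N. \<tau> * (b + C * ?d i - m) * ?K i) / real N ^ CARD('d)"
  proof (intro divide_right_mono sum_mono mult_right_mono mult_left_mono)
    fix i :: "nat^'d" assume "i \<in> grid_idx N"
    then have "u (wrap N (int_vec i + z)) - u i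
        \<le> L (to_torus (grid_point N i)) ((1 / (\<tau> * real N)) *\<^sub>R zvec z) - m"
      using potential_shift[OF u \<open>N \<ge> 1\<close>, of "int_vec i" z] by (simp add: wrap_int_vec)
    then show "u (wrap N (int_vec i + z)) - u i \<le> b + C * ?d i - m"
      using F[of "grid_point N i"] by linarith
  qed (use \<open>\<tau> > 0\<close> mollifier_nonneg in auto)
  also have "(\<Sum>i\<in>grid_idx N. \<tau> * (b + C * ?d i - m) * ?K i)
      = \<tau> * (b - m) * (\<Sum>i\<in>grid_idx N. ?K i) + \<tau> * C * (\<Sum>i\<in>grid_idx N. ?K i * ?d i)"
    by (simp add: sum_distrib_left sum.distrib[symmetric] algebra_simps)
  also have "(\<Sum>i\<in>grid_idx N. ?K i * ?d i)
      = (\<Sum>k\<in>UNIV. \<Sum>i\<in>grid_idx N. ?K i * (1 - cos (2 * pi * (y $ k - grid_point N i $ k))))"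
    unfolding sum_distrib_left by (rule sum.swap)
  also have "\<dots> = real CARD('d) * (real N ^ CARD('d) / (real M + 1))"
    by (simp add: sum_mollifier_dist[OF \<open>Suc M < N\<close>])
  also have "(\<Sum>i\<in>grid_idx N. ?K i) = real N ^ CARD('d)"
    by (rule sum_mollifier[OF Suc_lessD[OF \<open>Suc M < N\<close>]])
  also have "(\<tau> * (b - m) * real N ^ CARD('d) + \<tau> * C * (real CARD('d) * (real N ^ CARD('d) / (real M + 1))))
      / real N ^ CARD('d) = \<tau> * (b + C * real CARD('d) / (real M + 1) - m)"
    using \<open>N \<ge> 1\<close> by (simp add: divide_simps) (simp add: algebra_simps)
  finally show ?thesis .
qed

section \<open>Smooth approximate subsolutions\<close>

text \<open>Rounding brings each coordinate difference into \<open>[-1/2, 1/2]\<close>, where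
  \<open>1 - cos (2 * pi * t)\<close> increases with \<open>\<bar>t\<bar>\<close>; hence small
  values force closeness modulo the lattice.\<close>

lemma cos_dist_modulus:
  assumes "\<delta> > 0"
  obtains \<gamma> where "\<gamma> > 0"
    "\<And>y y' :: real^'d::finite. (\<And>k. 1 - cos (2 * pi * (y $ k - y' $ k)) < \<gamma>) \<Longrightarrow> \<exists>l. norm (y' + zvec l - y) < \<delta>"
proof -
  \<comment> \<open>At most 1/2, to stay where the cosine decreases; the dimension pays for passing
    from coordinates to the norm.\<close>
  define \<epsilon> where "\<epsilon> = min (1/2) (\<delta> / (2 * real CARD('d)))"
  have "\<epsilon> > 0" using assms by (simp add: \<epsilon>_def)
  define \<gamma> where "\<gamma> = 1 - cos (2 * pi * \<epsilon>)"
  have "cos (2 * pi * \<epsilon>) < cos 0"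
    using \<open>\<epsilon> > 0\<close> by (intro cos_monotone_0_pi) (auto simp: \<epsilon>_def min_def field_simps)
  then have "\<gamma> > 0" by (simp add: \<gamma>_def)
  have "\<exists>l. norm (y' + zvec l - y) < \<delta>"
    if close: "\<And>k. 1 - cos (2 * pi * (y $ k - y' $ k)) < \<gamma>" for y y' :: "real^'d"
  proof
    define l :: "int^'d" where "l = (\<chi> k. round (y $ k - y' $ k))"
    have "\<bar>(y' + zvec l - y) $ k\<bar> \<le> \<epsilon>" for k
    proof (rule ccontr)
      let ?t = "y $ k - y' $ k - real_of_int (round (y $ k - y' $ k))"
      assume "\<not> \<bar>(y' + zvec l - y) $ k\<bar> \<le> \<epsilon>"
      then have "\<epsilon> < \<bar>?t\<bar>" by (auto simp: l_def zvec_def)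
      moreover have "\<bar>?t\<bar> \<le> 1/2"
        using of_int_round_abs_le[of "y $ k - y' $ k"] by linarith
      ultimately have "cos (2 * pi * \<bar>?t\<bar>) \<le> cos (2 * pi * \<epsilon>)"
        using \<open>\<epsilon> > 0\<close> by (intro cos_monotone_0_pi_le) auto
      moreover have "cos (2 * pi * \<bar>t\<bar>) = cos (2 * pi * t)" for t
        by (cases "t \<ge> 0") auto
      then have "cos (2 * pi * \<bar>?t\<bar>) = cos (2 * pi * ?t)" .
      moreover have "cos (2 * pi * ?t) = cos (2 * pi * (y $ k - y' $ k))"
        using cos_sin_add_int(1)[of "?t" "round (y $ k - y' $ k)"] by simp
      ultimately show False using close[of k] by (simp add: \<gamma>_def)
    qed
    then have "norm (y' + zvec l - y) \<le> real CARD('d) * \<epsilon>" by (rule norm_le_card)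
    also have "\<dots> \<le> real CARD('d) * (\<delta> / (2 * real CARD('d)))"
      by (intro mult_left_mono) (auto simp: \<epsilon>_def)
    also have "\<dots> < \<delta>" using assms by simp
    finally show "norm (y' + zvec l - y) < \<delta>" .
  qed
  then show ?thesis using \<open>\<gamma> > 0\<close> that by blast
qed

locale superlinear_lagrangian =
  fixes L :: "'d::finite torus \<Rightarrow> real^'d \<Rightarrow> real"
  assumes continuous: "continuous_on UNIV (\<lambda>(x, v). L x v)" and superlinear: "superlinear L"
begin

lemma bounded_velocity:
  obtains B where "B > 0" "\<And>x v. norm v \<le> R \<Longrightarrow> \<bar>L x v\<bar> \<le> B"
  using bounded_on_torus_times_compact[OF continuous compact_cball[of 0 R]]
  by (metis mem_cball_0)

lemma uniformly_continuous:
  assumes "e > 0"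
  obtains d where "d > 0" "\<And>y y' v v'. norm v \<le> R \<Longrightarrow> norm v' \<le> R \<Longrightarrow> norm (y' - y) < d \<Longrightarrow>
    norm (v' - v) < d \<Longrightarrow> \<bar>L (to_torus y') v' - L (to_torus y) v\<bar> < e"
proof -
  let ?f = "\<lambda>(y, v). L (to_torus y) v"
  have "continuous_on UNIV (\<lambda>z. (\<lambda>(x, v). L x v) (to_torus (fst z), snd z))"
    by (rule continuous_on_compose2[OF continuous])
       (auto intro!: continuous_intros continuous_on_compose2[OF continuous_to_torus])
  then have "continuous_on UNIV ?f" by (simp add: split_beta)
  then have "uniformly_continuous_on (UNIV \<times> cball 0 R) ?f"
    by (intro periodic_uniformly_continuous) (auto intro: continuous_on_subset)
  then obtain d where d: "d > 0" "\<And>z z'. z \<in> UNIV \<times> cball 0 R \<Longrightarrow> z' \<in> UNIV \<times> cball 0 R \<Longrightarrow>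
      dist z' z < d \<Longrightarrow> dist (?f z') (?f z) < e"
    using assms unfolding uniformly_continuous_on_def by metis
  show ?thesis
  proof (rule that[of "d / 2"])
    fix y y' v v' :: "real^'d"
    assume *: "norm v \<le> R" "norm v' \<le> R" "norm (y' - y) < d / 2" "norm (v' - v) < d / 2"
    have "dist (y', v') (y, v) \<le> dist y' y + dist v' v"
      unfolding dist_Pair_Pair by (rule sqrt_sum_squares_le_sum) auto
    then have "dist (y', v') (y, v) < d" using * by (simp add: dist_norm)
    then show "\<bar>L (to_torus y') v' - L (to_torus y) v\<bar> < e"
      using d(2)[of "(y, v)" "(y', v')"] * by (simp add: dist_real_def)
  qed (use d in auto)
qed

text \<open>A modulus of continuity in \<open>x\<close>, in the form that the kernel average can
  evaluate. Points close modulo the lattice are covered by \<open>e\<close>; otherwise some summand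
  is at least \<open>\<gamma>\<close>, and \<open>C = 2 * B / \<gamma>\<close> pays for the trivial
  bound \<open>2 * B\<close>.\<close>

lemma cos_dist_bound:
  assumes "e > 0"
  obtains C where "C \<ge> 0" "\<And>y y' v. norm v \<le> R \<Longrightarrow>
    L (to_torus y') v \<le> L (to_torus y) v + e + C * (\<Sum>k\<in>UNIV. 1 - cos (2 * pi * (y $ k - y' $ k)))"
proof -
  obtain B where B: "B > 0" "\<And>x v. norm v \<le> R \<Longrightarrow> \<bar>L x v\<bar> \<le> B"
    using bounded_velocity[where R=R] by metis
  obtain d where d: "d > 0" "\<And>y y' v v'. norm v \<le> R \<Longrightarrow> norm v' \<le> R \<Longrightarrow> norm (y' - y) < d \<Longrightarrow>
      norm (v' - v) < d \<Longrightarrow> \<bar>L (to_torus y') v' - L (to_torus y) v\<bar> < e"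
    using uniformly_continuous[OF assms, where R=R] by metis
  obtain \<gamma> where \<gamma>: "\<gamma> > 0" "\<And>y y' :: real^'d. (\<And>k. 1 - cos (2 * pi * (y $ k - y' $ k)) < \<gamma>) \<Longrightarrow>
      \<exists>l. norm (y' + zvec l - y) < d"
    using cos_dist_modulus[OF d(1), where ?'d = 'd] by metis
  have "L (to_torus y') v \<le> L (to_torus y) v + e + 2 * B / \<gamma> * (\<Sum>k\<in>UNIV. 1 - cos (2 * pi * (y $ k - y' $ k)))"
    (is "_ \<le> _ + _ * ?s") if v: "norm v \<le> R" for y y' v
  proof (cases "\<forall>k. 1 - cos (2 * pi * (y $ k - y' $ k)) < \<gamma>")
    case True
    then obtain l where "norm (y' + zvec l - y) < d" using \<gamma>(2) by metis
    then have "\<bar>L (to_torus (y' + zvec l)) v - L (to_torus y) v\<bar> < e"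
      using v d(1) by (intro d(2)) auto
    moreover have "0 \<le> 2 * B / \<gamma> * ?s"
      using B(1) \<gamma>(1) by (intro mult_nonneg_nonneg sum_nonneg) auto
    ultimately show ?thesis by simp
  next
    case False
    then obtain k where "\<gamma> \<le> 1 - cos (2 * pi * (y $ k - y' $ k))" by (auto simp: not_less)
    also have "\<dots> \<le> ?s" by (rule member_le_sum) auto
    finally have "2 * B / \<gamma> * \<gamma> \<le> 2 * B / \<gamma> * ?s"
      using B(1) \<gamma>(1) by (intro mult_left_mono) auto
    then have "2 * B \<le> 2 * B / \<gamma> * ?s" using \<gamma>(1) by simp
    then show ?thesis
      using B(2)[OF v, of "to_torus y"] B(2)[OF v, of "to_torus y'"] assms by linarith
  qed
  then show ?thesis
    using B(1) \<gamma>(1) by (intro that[of "2 * B / \<gamma>"]) auto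
qed

text \<open>Grid displacements realize a lattice of velocities with spacing
  \<open>h / \<tau>\<close>; round down in each coordinate.\<close>

lemma nearby_grid_velocity:
  fixes v :: "real^'d"
  assumes "\<tau> > 0" "N \<ge> 1"
  obtains z where "norm (v - (1 / (\<tau> * real N)) *\<^sub>R zvec z) \<le> real CARD('d) * (1 / real N / \<tau>)"
proof
  define c where "c = \<tau> * real N"
  have "c > 0" using assms by (simp add: c_def)
  show "norm (v - (1 / (\<tau> * real N)) *\<^sub>R zvec (\<chi> k. \<lfloor>c * v $ k\<rfloor>)) \<le> real CARD('d) * (1 / real N / \<tau>)"
  proof (rule norm_le_card)
    fix k
    have "\<bar>c * v $ k - real_of_int \<lfloor>c * v $ k\<rfloor>\<bar> \<le> 1" by linarith
    then have "\<bar>(c * v $ k - real_of_int \<lfloor>c * v $ k\<rfloor>) / c\<bar> \<le> 1 / c"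
      using \<open>c > 0\<close> by (simp add: divide_right_mono)
    moreover have "(v - (1 / (\<tau> * real N)) *\<^sub>R zvec (\<chi> k. \<lfloor>c * v $ k\<rfloor>)) $ k
        = (c * v $ k - real_of_int \<lfloor>c * v $ k\<rfloor>) / c"
      using \<open>c > 0\<close> by (simp add: zvec_def c_def[symmetric] diff_divide_distrib)
    ultimately show "\<bar>(v - (1 / (\<tau> * real N)) *\<^sub>R zvec (\<chi> k. \<lfloor>c * v $ k\<rfloor>)) $ k\<bar> \<le> 1 / real N / \<tau>"
      by (simp add: c_def mult.commute)
  qed
qed

text \<open>For given \<open>v\<close>, compare with a grid velocity \<open>w\<close> nearby and
  divide the increment of the smoothed potential along \<open>\<tau> * w\<close> by
  \<open>\<tau>\<close>. The budget for \<open>\<delta>\<close> is a quarter each for the modulus in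
  \<open>x\<close>, the spread of the kernel and the replacement of \<open>v\<close> by
  \<open>w\<close> in \<open>L\<close>, and an eighth each for the Taylor remainder and for
  \<open>v - w\<close> paired with the gradient.\<close>

lemma local_subsolution:
  fixes N :: "nat \<Rightarrow> nat" and \<tau> m :: "nat \<Rightarrow> real" and u :: "nat \<Rightarrow> nat^'d \<Rightarrow> real"
  assumes N: "\<And>n. N n \<ge> 1" and \<tau>: "\<And>n. \<tau> n > 0"
    and lim\<tau>: "\<tau> \<longlonglongrightarrow> 0" and limh: "(\<lambda>n. 1 / real (N n)) \<longlonglongrightarrow> 0"
    and limq: "(\<lambda>n. 1 / real (N n) / \<tau> n) \<longlonglongrightarrow> 0"
    and m: "\<And>n. \<bar>m n\<bar> \<le> mb" and u: "\<And>n. grid_potential L (N n) (\<tau> n) (m n) (u n)"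
    and "R \<ge> 0" "\<delta> > 0"
  shows "\<forall>\<^sub>F n in sequentially. \<exists>f G. (\<forall>y l. f (y + zvec l) = f y) \<and> (\<forall>y l. G (y + zvec l) = G y) \<and>
     (\<forall>y. GDERIV f y :> G y) \<and> continuous_on UNIV G \<and>
     (\<forall>y v. norm v \<le> R \<longrightarrow> v \<bullet> G y \<le> L (to_torus y) v - m n + \<delta>)"
proof -
  let ?d = "real CARD('d)"
  obtain B where B: "B > 0" "\<And>x v. norm v \<le> 2 * ?d \<Longrightarrow> \<bar>L x v\<bar> \<le> B"
    using bounded_velocity[where R="2 * ?d"] by metis
  obtain C where C: "C \<ge> 0" "\<And>y y' v. norm v \<le> R + 1 \<Longrightarrow>
    L (to_torus y') v \<le> L (to_torus y) v + \<delta>/4 + C * (\<Sum>k\<in>UNIV. 1 - cos (2 * pi * (y $ k - y' $ k)))"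
    using cos_dist_bound[of "\<delta>/4" "R + 1"] \<open>\<delta> > 0\<close> by auto
  obtain M :: nat where "C * ?d / (\<delta>/4) \<le> real M" using real_arch_simple by blast
  then have M: "C * ?d / (real M + 1) \<le> \<delta>/4" using \<open>\<delta> > 0\<close> by (simp add: field_simps)
  obtain \<eta> where \<eta>: "\<eta> > 0" "\<And>y v v'. norm v \<le> R + 1 \<Longrightarrow> norm v' \<le> R + 1 \<Longrightarrow>
      norm (v' - v) < \<eta> \<Longrightarrow> \<bar>L (to_torus y) v' - L (to_torus y) v\<bar> < \<delta>/4"
    using uniformly_continuous[of "\<delta>/4" "R + 1"] \<open>\<delta> > 0\<close>
    by (metis cancel_comm_monoid_add_class.diff_cancel divide_pos_pos norm_zero zero_less_numeral)
  obtain BK where BK: "BK > 0" "\<And>y :: real^'d. norm (mollifier_grad M y) \<le> BK"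
    using periodic_bounded[OF continuous_mollifier_grad mollifier_grad_periodic] by metis
  \<comment> \<open>Bounds the oscillation \<open>2 * (B - m n)\<close> of the scaled potential for
    all \<open>n\<close>.\<close>
  define D where "D = 2 * (B + mb)"
  have "mb \<ge> 0" using m[of 0] by linarith
  then have "D > 0" using B by (simp add: D_def)
  \<comment> \<open>Makes the Taylor error over a step of length at most
    \<open>\<tau> * (R + 1)\<close> equal to \<open>\<tau> * \<delta> / 8\<close>, which is still
    small after division by \<open>\<tau>\<close>.\<close>
  define \<rho> where "\<rho> = \<delta> / (8 * D * (R + 1))"
  have "\<rho> > 0" using \<open>\<delta> > 0\<close> \<open>D > 0\<close> \<open>R \<ge> 0\<close> by (simp add: \<rho>_def)
  obtain r where r: "r > 0" "\<And>y h :: real^'d. norm h \<le> r \<Longrightarrow>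
      \<bar>mollifier M (y + h) - mollifier M y - mollifier_grad M y \<bullet> h\<bar> \<le> \<rho> * norm h"
    using periodic_GDERIV_remainder[OF mollifier_GDERIV continuous_mollifier_grad
        mollifier_grad_periodic \<open>\<rho> > 0\<close>] by metis
  have "\<forall>\<^sub>F n in sequentially. \<tau> n < min 1 (r / (R + 1))"
    by (rule order_tendstoD[OF lim\<tau>]) (use r \<open>R \<ge> 0\<close> in auto)
  moreover have "\<forall>\<^sub>F n in sequentially. 1 / real (N n) < 1 / real (Suc M)"
    by (rule order_tendstoD[OF limh]) auto
  \<comment> \<open>The three thresholds keep \<open>w\<close> in the ball of radius
    \<open>R + 1\<close>, keep \<open>L\<close> at \<open>w\<close> close to \<open>L\<close> at
    \<open>v\<close>, and control the gradient paired with \<open>v - w\<close>.\<close>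
  moreover have "\<forall>\<^sub>F n in sequentially. 1 / real (N n) / \<tau> n < min (1 / ?d) (min (\<eta> / ?d) (\<delta> / (8 * D * BK * ?d)))"
    by (rule order_tendstoD[OF limq]) (use \<eta> \<open>\<delta> > 0\<close> \<open>D > 0\<close> BK(1) in auto)
  ultimately show ?thesis
  proof eventually_elim
    case (elim n)
    let ?N = "N n" and ?\<tau> = "\<tau> n"
    have NM: "Suc M < ?N" using elim(2) N[of n] by (simp add: divide_simps split: if_splits)
    have small: "?d * (1 / real ?N / ?\<tau>) \<le> 1" "?d * (1 / real ?N / ?\<tau>) < \<eta>"
      "D * BK * (?d * (1 / real ?N / ?\<tau>)) \<le> \<delta>/8"
    proof -
      have dpos: "?d > 0" "?d \<ge> 1" by simp_all
      have "1 / real ?N / ?\<tau> < 1 / ?d" "1 / real ?N / ?\<tau> < \<eta> / ?d" "1 / real ?N / ?\<tau> < \<delta> / (8 * D * BK * ?d)"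
        using elim(3) by auto
      note * = this[THEN less_imp_le]
      show "?d * (1 / real ?N / ?\<tau>) \<le> 1"
        using mult_left_mono[OF *(1), of ?d] dpos by simp
      show "?d * (1 / real ?N / ?\<tau>) < \<eta>"
        using mult_strict_left_mono[OF \<open>1 / real ?N / ?\<tau> < \<eta> / ?d\<close>, of ?d] dpos by simp
      show "D * BK * (?d * (1 / real ?N / ?\<tau>)) \<le> \<delta>/8"
        using mult_left_mono[OF *(3), of "D * BK * ?d"] dpos \<open>D > 0\<close> BK(1) by (simp add: mult.assoc)
    qed
    have "1 / real ?N \<le> ?\<tau>"
    proof -
      have "1 / real ?N / ?\<tau> \<le> 1 / ?d" using elim(3) by auto
      also have "\<dots> \<le> 1" by (simp add: field_simps Suc_leI)
      finally show ?thesis using divide_le_eq_1_pos[OF \<tau>[of n]] by blast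
    qed
    \<comment> \<open>Subtracting the value at one node turns the oscillation bound into a bound on
      the supremum.\<close>
    define U where "U = (\<lambda>i. ?\<tau> * (u n i - u n 0))"
    have U: "\<bar>U i\<bar> \<le> D" if i: "i \<in> grid_idx ?N" for i
    proof -
      have 0: "0 \<in> grid_idx ?N" using N[of n] by (simp add: grid_idx_def)
      have "?\<tau> * (u n b - u n a) \<le> D" if "a \<in> grid_idx ?N" "b \<in> grid_idx ?N" for a b
      proof -
        have "?\<tau> * (u n b - u n a) \<le> 2 * (B - m n)"
          using potential_oscillation[OF u N \<tau> _ \<open>1 / real ?N \<le> ?\<tau>\<close> _ that, of B] elim(1) B(2)
          by (auto simp: abs_le_iff)
        also have "\<dots> \<le> D" using m[of n] by (simp add: D_def)
        finally show ?thesis .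
      qed
      from this[OF 0 i] this[OF i 0] show ?thesis
        by (simp add: U_def abs_le_iff algebra_simps)
    qed
    have main: "v \<bullet> smoothing_grad M ?N U y \<le> L (to_torus y) v - m n + \<delta>" if v: "norm v \<le> R" for y v
    proof -
      obtain z where z: "norm (v - (1 / (?\<tau> * real ?N)) *\<^sub>R zvec z) \<le> ?d * (1 / real ?N / ?\<tau>)"
        by (rule nearby_grid_velocity[OF \<tau> N])
      define w where "w = (1 / (?\<tau> * real ?N)) *\<^sub>R zvec z"
      define h where "h = (1 / real ?N) *\<^sub>R zvec z"
      have h: "h = ?\<tau> *\<^sub>R w" using \<tau>[of n] by (simp add: h_def w_def)
      have vw: "norm (v - w) \<le> ?d * (1 / real ?N / ?\<tau>)" using z by (simp add: w_def)
      have w: "norm w \<le> R + 1"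
        using vw small(1) v norm_triangle_ineq4[of v "v - w"] by simp
      have hw: "norm h = ?\<tau> * norm w" using \<tau>[of n] by (simp add: h)
      have hR: "norm h \<le> ?\<tau> * (R + 1)" unfolding hw using w \<tau>[of n] by simp
      also have "\<dots> \<le> r" using elim(1) \<open>R \<ge> 0\<close> by (simp add: pos_less_divide_eq)
      finally have hr: "norm h \<le> r" .
      have "smoothing M ?N U (y + h) - smoothing M ?N U y
          \<le> ?\<tau> * (L (to_torus y) w + \<delta>/4 + C * ?d / (real M + 1) - m n)"
        unfolding U_def h_def
        by (rule smoothing_increment[OF u \<tau> NM]) (use C(2)[OF w] in \<open>simp add: w_def\<close>)
      moreover have "\<bar>smoothing M ?N U (y + h) - smoothing M ?N U y - smoothing_grad M ?N U y \<bullet> h\<bar>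
          \<le> D * (\<rho> * norm h)"
        by (rule smoothing_remainder[OF N U r(2)[OF hr]])
      moreover have "D * (\<rho> * norm h) \<le> ?\<tau> * (\<delta>/8)"
      proof -
        have "D * (\<rho> * norm h) \<le> D * (\<rho> * (?\<tau> * (R + 1)))"
          using hR \<open>D > 0\<close> \<open>\<rho> > 0\<close> by simp
        also have "\<dots> = ?\<tau> * (\<delta>/8)"
          using \<open>D > 0\<close> \<open>R \<ge> 0\<close> by (simp add: \<rho>_def divide_simps)
        finally show ?thesis .
      qed
      ultimately have "smoothing_grad M ?N U y \<bullet> h
          \<le> ?\<tau> * (L (to_torus y) w + \<delta>/4 + C * ?d / (real M + 1) - m n) + ?\<tau> * (\<delta>/8)"
        by linarith
      then have "?\<tau> * (smoothing_grad M ?N U y \<bullet> w)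
          \<le> ?\<tau> * (L (to_torus y) w + \<delta>/4 + C * ?d / (real M + 1) - m n + \<delta>/8)"
        by (simp add: h algebra_simps)
      then have 1: "smoothing_grad M ?N U y \<bullet> w \<le> L (to_torus y) w + \<delta>/4 + \<delta>/4 - m n + \<delta>/8"
        using \<tau>[of n] M by simp
      have "smoothing_grad M ?N U y \<bullet> (v - w) \<le> norm (smoothing_grad M ?N U y) * norm (v - w)"
        by (rule norm_cauchy_schwarz)
      also have "\<dots> \<le> D * BK * (?d * (1 / real ?N / ?\<tau>))"
        by (intro mult_mono smoothing_grad_bound[OF N U BK(2)] vw) (use \<open>D > 0\<close> BK(1) in auto)
      finally have 2: "smoothing_grad M ?N U y \<bullet> (v - w) \<le> \<delta>/8" using small(3) by linarith
      have "\<bar>L (to_torus y) v - L (to_torus y) w\<bar> < \<delta>/4"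
        using v w vw small(2) by (intro \<eta>(2)) auto
      then show ?thesis
        using 1 2 unfolding inner_diff_right inner_commute[of v] by linarith
    qed
    show ?case
      by (intro exI[of _ "smoothing M ?N U"] exI[of _ "smoothing_grad M ?N U"] conjI allI impI
          smoothing_periodic smoothing_grad_periodic smoothing_GDERIV continuous_smoothing_grad main)
  qed
qed

text \<open>Testing with \<open>\<bar>v\<bar> \<le> 1\<close> bounds the gradient, so superlinearity takes care of large velocities.\<close>

lemma global_subsolution:
  fixes N :: "nat \<Rightarrow> nat" and \<tau> m :: "nat \<Rightarrow> real" and u :: "nat \<Rightarrow> nat^'d \<Rightarrow> real"
  assumes N: "\<And>n. N n \<ge> 1" and \<tau>: "\<And>n. \<tau> n > 0"
    and lim\<tau>: "\<tau> \<longlonglongrightarrow> 0" and limh: "(\<lambda>n. 1 / real (N n)) \<longlonglongrightarrow> 0"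
    and limq: "(\<lambda>n. 1 / real (N n) / \<tau> n) \<longlonglongrightarrow> 0"
    and m: "\<And>n. \<bar>m n\<bar> \<le> mb" and u: "\<And>n. grid_potential L (N n) (\<tau> n) (m n) (u n)"
    and "\<delta> > 0"
  shows "\<forall>\<^sub>F n in sequentially. \<exists>\<phi> G. C1_torus_gradient \<phi> G \<and> (\<forall>x v. v \<bullet> G x \<le> L x v - m n + \<delta>)"
proof -
  obtain B where B: "B > 0" "\<And>x v. norm v \<le> 1 \<Longrightarrow> \<bar>L x v\<bar> \<le> B"
    using bounded_velocity[where R=1] by metis
  \<comment> \<open>The gradient bound obtained from unit vectors; the last 1 accounts for
    \<open>min \<delta> 1\<close>.\<close>
  define K where "K = B + mb + 1"
  have "mb \<ge> 0" using m[of 0] by linarith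
  then have "K > 0" using B by (simp add: K_def)
  obtain c where c: "\<And>x v. L x v \<ge> (K + 1) * norm v - c"
    using superlinear \<open>K > 0\<close> unfolding superlinear_def by (metis add_pos_pos zero_less_one)
  \<comment> \<open>Beyond \<open>c + mb\<close> the growth of slope \<open>K + 1\<close> exceeds
    \<open>K * norm v\<close> by enough to absorb the constants; the lower limit 1 admits the unit
    test vectors.\<close>
  define R where "R = max 1 (c + mb)"
  have "\<forall>\<^sub>F n in sequentially. \<exists>f G. (\<forall>y l. f (y + zvec l) = f y) \<and> (\<forall>y l. G (y + zvec l) = G y) \<and>
     (\<forall>y. GDERIV f y :> G y) \<and> continuous_on UNIV G \<and>
     (\<forall>y v. norm v \<le> R \<longrightarrow> v \<bullet> G y \<le> L (to_torus y) v - m n + min \<delta> 1)"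
    by (rule local_subsolution[OF N \<tau> lim\<tau> limh limq m u]) (use \<open>\<delta> > 0\<close> in \<open>auto simp: R_def\<close>)
  then show ?thesis
  proof eventually_elim
    case (elim n)
    then obtain f :: "real^'d \<Rightarrow> real" and G where per: "\<And>y l. f (y + zvec l) = f y" "\<And>y l. G (y + zvec l) = G y"
      and deriv: "\<And>y. GDERIV f y :> G y" and cont: "continuous_on UNIV G"
      and sub: "\<And>y v. norm v \<le> R \<Longrightarrow> v \<bullet> G y \<le> L (to_torus y) v - m n + min \<delta> 1"
      by metis
    have factor: "f (rep_torus (to_torus y)) = f y" "G (rep_torus (to_torus y)) = G y" for y
      using per by (auto intro: periodic_factors)
    have grad: "norm (G y) \<le> K" for y
    proof -
      have "norm (sgn (G y)) \<le> 1" by (simp add: norm_sgn)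
      then have "sgn (G y) \<bullet> G y \<le> L (to_torus y) (sgn (G y)) - m n + min \<delta> 1"
        by (intro sub) (simp add: R_def)
      also have "\<dots> \<le> K"
        using B(2)[OF \<open>norm (sgn (G y)) \<le> 1\<close>, of "to_torus y"] m[of n] unfolding K_def by linarith
      also have "sgn (G y) \<bullet> G y = norm (G y)"
        by (cases "G y = 0") (auto simp: sgn_div_norm dot_square_norm power2_eq_square)
      finally show ?thesis .
    qed
    have "v \<bullet> G (rep_torus x) \<le> L x v - m n + \<delta>" for x v
    proof (cases "norm v \<le> R")
      case True
      then show ?thesis using sub[OF True, of "rep_torus x"] by simp
    next
      case False
      have "v \<bullet> G (rep_torus x) \<le> norm v * norm (G (rep_torus x))" by (rule norm_cauchy_schwarz)
      also have "\<dots> \<le> norm v * K" by (intro mult_left_mono grad) auto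
      also have "\<dots> \<le> (K + 1) * norm v - c - mb" using False by (simp add: R_def algebra_simps)
      also have "\<dots> \<le> L x v - m n + \<delta>" using c[of v x] m[of n] \<open>\<delta> > 0\<close> by linarith
      finally show ?thesis .
    qed
    moreover have "C1_torus_gradient (\<lambda>x. f (rep_torus x)) (\<lambda>x. G (rep_torus x))"
      unfolding C1_torus_gradient_def
      by (auto simp: factor deriv cont intro!: continuous_on_torus)
    ultimately show ?case by blast
  qed
qed

end

section \<open>Integrals of continuous functions and their truncations\<close>

lemma borel_measurable_continuous:
  assumes "borel_probability M" and "continuous_on UNIV f"
  shows "f \<in> borel_measurable M"
  using borel_measurable_continuous_onI[OF assms(2)] assms(1)
  by (auto simp: borel_probability_def cong: measurable_cong_sets)

lemma integrable_bounded_continuous: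
  fixes f :: "'a::topological_space \<Rightarrow> real"
  assumes "borel_probability M" and "continuous_on UNIV f" and "\<And>z. \<bar>f z\<bar> \<le> b"
  shows "integrable M f"
proof -
  interpret prob_space M using assms(1) by (simp add: borel_probability_def)
  show ?thesis
    using borel_measurable_continuous[OF assms(1,2)] assms(3) by (intro integrable_const_bound) auto
qed

lemma abs_integral_le:
  fixes f g :: "'a \<Rightarrow> real"
  assumes "f \<in> borel_measurable M" "integrable M g" "\<And>z. \<bar>f z\<bar> \<le> g z"
  shows "integrable M f" "\<bar>\<integral>z. f z \<partial>M\<bar> \<le> (\<integral>z. g z \<partial>M)"
proof -
  show *: "integrable M f"
    by (rule Bochner_Integration.integrable_bound[OF assms(2,1)])
       (use assms(3) in \<open>auto intro: order_trans[OF _ abs_ge_self]\<close>)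
  have "\<bar>\<integral>z. f z \<partial>M\<bar> \<le> (\<integral>z. \<bar>f z\<bar> \<partial>M)" by (rule integral_abs_bound)
  also have "\<dots> \<le> (\<integral>z. g z \<partial>M)"
    by (rule integral_mono) (use * assms in auto)
  finally show "\<bar>\<integral>z. f z \<partial>M\<bar> \<le> (\<integral>z. g z \<partial>M)" .
qed

text \<open>Narrow convergence sees only bounded functions. Bounds are therefore passed to the limit
  for truncations, and monotone convergence then yields both integrability and the bound.\<close>

lemma integral_truncation:
  fixes E :: "'a::topological_space \<Rightarrow> real"
  assumes \<nu>: "borel_probability \<nu>" and cont: "continuous_on UNIV E" and nonneg: "\<And>z. E z \<ge> 0"
    and bound: "\<And>j. (\<integral>z. min (E z) (real j) \<partial>\<nu>) \<le> A"
  shows "integrable \<nu> E" "(\<integral>z. E z \<partial>\<nu>) \<le> A"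
proof -
  have int: "integrable \<nu> (\<lambda>z. min (E z) (real j))" for j
  proof (rule integrable_bounded_continuous[OF \<nu>])
    show "continuous_on UNIV (\<lambda>z. min (E z) (real j))"
      by (intro continuous_intros cont)
    show "\<bar>min (E z) (real j)\<bar> \<le> real j" for z
      using nonneg[of z] by (auto simp: min_def)
  qed
  have "incseq (\<lambda>j. \<integral>z. min (E z) (real j) \<partial>\<nu>)"
    by (intro incseq_SucI integral_mono int) auto
  then obtain s where s: "(\<lambda>j. \<integral>z. min (E z) (real j) \<partial>\<nu>) \<longlonglongrightarrow> s"
    using incseq_convergent[of "\<lambda>j. \<integral>z. min (E z) (real j) \<partial>\<nu>" A] bound by metis
  have lim: "(\<lambda>j. min (E z) (real j)) \<longlonglongrightarrow> E z" for z
  proof (rule tendsto_eventually)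
    obtain J :: nat where "E z \<le> real J" using real_arch_simple by blast
    then show "\<forall>\<^sub>F j in sequentially. min (E z) (real j) = E z"
      by (auto simp: eventually_sequentially min_def intro!: exI[of _ J])
  qed
  have mono: "incseq (\<lambda>j. min (E z) (real j))" for z
    by (auto simp: incseq_def min_le_iff_disj)
  have meas: "E \<in> borel_measurable \<nu>" by (rule borel_measurable_continuous[OF \<nu> cont])
  note convergence = integral_monotone_convergence_nonneg[OF int _ _ _ s meas]
  show "integrable \<nu> E"
    by (rule convergence(1)) (use lim mono nonneg in auto)
  have "(\<integral>z. E z \<partial>\<nu>) = s"
    by (rule convergence(2)) (use lim mono nonneg in auto)
  also have "s \<le> A" using s bound by (intro LIMSEQ_le_const2) auto
  finally show "(\<integral>z. E z \<partial>\<nu>) \<le> A" .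
qed

section \<open>Discrete Mather measures and their limits\<close>

locale discrete_mather_sequence = superlinear_lagrangian L for L :: "'d::finite torus \<Rightarrow> real^'d \<Rightarrow> real" +
  fixes N :: "nat \<Rightarrow> nat" and \<tau> :: "nat \<Rightarrow> real" and \<mu> :: "nat \<Rightarrow> 'd weights"
  assumes N: "\<And>n. N n \<ge> 1" and \<tau>: "\<And>n. \<tau> n > 0"
    and lim\<tau>: "\<tau> \<longlonglongrightarrow> 0" and limh: "(\<lambda>n. 1 / real (N n)) \<longlonglongrightarrow> 0"
    and limq: "(\<lambda>n. 1 / real (N n) / \<tau> n) \<longlonglongrightarrow> 0"
    and mather: "\<And>n. discrete_mather_measure L (N n) (\<tau> n) (\<mu> n)"
begin

section \<open>The minimal discrete action\<close>

abbreviation cost :: "nat \<Rightarrow> 'd weights" where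
  "cost n i j l \<equiv> L (to_torus (grid_point (N n) i)) (velocity (N n) (\<tau> n) i j l)"

abbreviation M :: "nat \<Rightarrow> ('d torus \<times> (real^'d)) measure" where
  "M n \<equiv> reconstruction (N n) (\<tau> n) (\<mu> n)"

definition minimum :: "nat \<Rightarrow> real" where
  "minimum n = infsum (\<lambda>(i, j, l). cost n i j l * \<mu> n i j l) (weight_idx (N n))"

lemma holonomic: "\<mu> n \<in> discrete_holonomic (N n)"
  using mather[of n] by (simp add: discrete_mather_measure_def)

lemma discrete_action_eq:
  "((\<lambda>(i, j, l). cost n i j l * \<nu> i j l) has_sum s) (weight_idx (N n)) \<Longrightarrow>
    discrete_action L (N n) (\<tau> n) \<nu> = ereal s"
  by (auto simp: discrete_action_def Let_def infsumI dest: has_sum_imp_summable)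

lemma resting_measure:
  obtains \<nu> where "\<nu> \<in> discrete_holonomic (N n)"
    "((\<lambda>(i, j, l). cost n i j l * \<nu> i j l) has_sum L (to_torus 0) 0) (weight_idx (N n))"
proof -
  define \<nu> :: "'d weights" where "\<nu> = (\<lambda>i j l. of_bool ((i, j, l) = (0, 0, 0)))"
  have "0 \<in> grid_idx (N n)" using N[of n] by (simp add: grid_idx_def)
  then have flow: "unit_flow (N n) (cost n) 0 0 1 (cost n 0 0 0) \<nu>"
    unfolding \<nu>_def by (intro unit_flow_edge)
  moreover have "cost n 0 0 0 = L (to_torus 0) 0"
    by (simp add: grid_point_def velocity_def zero_vec_def[symmetric])
  ultimately show ?thesis
    unfolding unit_flow_def by (intro that[of \<nu>] discrete_holonomicI) auto
qed

text \<open>The resting mass has finite action, which excludes the default value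
  \<open>\<infinity>\<close> for the minimizer.\<close>

lemma has_sum_minimum:
  "((\<lambda>(i, j, l). cost n i j l * \<mu> n i j l) has_sum minimum n) (weight_idx (N n))"
proof -
  obtain \<nu> where \<nu>: "\<nu> \<in> discrete_holonomic (N n)"
    "((\<lambda>(i, j, l). cost n i j l * \<nu> i j l) has_sum L (to_torus 0) 0) (weight_idx (N n))"
    by (rule resting_measure)
  have "discrete_action L (N n) (\<tau> n) (\<mu> n) \<le> discrete_action L (N n) (\<tau> n) \<nu>"
    using mather[of n] \<nu>(1) by (simp add: discrete_mather_measure_def)
  also have "\<dots> = ereal (L (to_torus 0) 0)" by (rule discrete_action_eq[OF \<nu>(2)])
  finally have "discrete_action L (N n) (\<tau> n) (\<mu> n) \<le> ereal (L (to_torus 0) 0)" .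
  then have "(\<lambda>(i, j, l). cost n i j l * \<mu> n i j l) summable_on weight_idx (N n)"
    by (auto simp: discrete_action_def Let_def split: if_splits)
  then show ?thesis unfolding minimum_def by (rule has_sum_infsum)
qed

lemma minimum_le:
  assumes "\<nu> \<in> discrete_holonomic (N n)"
    and "((\<lambda>(i, j, l). cost n i j l * \<nu> i j l) has_sum s) (weight_idx (N n))"
  shows "minimum n \<le> s"
  using mather[of n] assms discrete_action_eq[OF has_sum_minimum] discrete_action_eq[OF assms(2)]
  unfolding discrete_mather_measure_def by (metis ereal_less_eq(3))

lemma minimum_le_rest: "minimum n \<le> L (to_torus 0) 0"
  by (rule resting_measure[of n]) (rule minimum_le)

section \<open>Energy bounds and tightness\<close>

definition shift :: real where
  "shift = (SOME c. c \<ge> 0 \<and> (\<forall>x v. L x v \<ge> norm v - c))"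

text \<open>The shifted Lagrangian dominates the speed and is thus nonnegative, so it can be
  truncated and also serves as a majorant for functions linear in \<open>v\<close>.\<close>

definition energy :: "'d torus \<times> (real^'d) \<Rightarrow> real" where
  "energy = (\<lambda>(x, v). L x v + shift)"

lemma shift: "shift \<ge> 0" "L x v \<ge> norm v - shift"
proof -
  obtain c where c: "\<And>x v. L x v \<ge> 1 * norm v - c"
    using superlinear unfolding superlinear_def by (metis zero_less_one)
  have "norm v - \<bar>c\<bar> \<le> L x v" for x v
    using c[of v x] abs_ge_self[of c] by linarith
  then have "\<exists>c. c \<ge> 0 \<and> (\<forall>x v. L x v \<ge> norm v - c)"
    by (intro exI[of _ "\<bar>c\<bar>"]) auto
  from someI_ex[OF this] show "shift \<ge> 0" "L x v \<ge> norm v - shift"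
    unfolding shift_def by blast+
qed

lemma energy_ge: "norm v \<le> energy (x, v)"
  using shift(2)[of v x] by (simp add: energy_def)

lemma energy_nonneg: "0 \<le> energy z"
  using order_trans[OF norm_ge_zero energy_ge] by (metis surj_pair)

lemma L_le_energy: "L x v \<le> energy (x, v)"
  using shift(1) by (simp add: energy_def)

lemma continuous_energy: "continuous_on UNIV energy"
  using continuous unfolding energy_def split_beta by (intro continuous_intros) (simp add: split_beta)

text \<open>Uniform integrability in pointwise form: superlinearity with slope
  \<open>B / \<eta>\<close>, multiplied by \<open>\<eta>\<close>.\<close>

lemma energy_tail:
  assumes "\<eta> > 0" "B > 0"
  obtains T where "T \<ge> 0" "\<And>x v. B * norm v - T \<le> \<eta> * energy (x, v)"
proof -
  obtain C where C: "\<And>x v. L x v \<ge> (B / \<eta>) * norm v - C"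
    using superlinear assms unfolding superlinear_def by (metis divide_pos_pos)
  have "B * norm v - \<bar>\<eta> * C\<bar> \<le> \<eta> * energy (x, v)" for x v
  proof -
    have "B * norm v - \<eta> * C = \<eta> * ((B / \<eta>) * norm v - C)"
      using assms by (simp add: right_diff_distrib)
    also have "\<dots> \<le> \<eta> * energy (x, v)"
      using C[of v x] L_le_energy[of x v] assms by (intro mult_left_mono) auto
    finally show ?thesis by linarith
  qed
  then show ?thesis by (intro that[of "\<bar>\<eta> * C\<bar>"]) auto
qed

lemma borel_probability_M: "borel_probability (M n)"
  by (rule borel_probability_reconstruction[OF holonomic])

lemma integral_energy:
  "has_bochner_integral (M n) energy (minimum n + shift)"
proof (rule reconstruction_integral[OF holonomic])
  show "energy \<in> borel_measurable borel"
    by (rule borel_measurable_continuous_onI[OF continuous_energy])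
  have "((\<lambda>e. (\<lambda>(i, j, l). cost n i j l * \<mu> n i j l) e + shift * (\<lambda>(i, j, l). \<mu> n i j l) e)
      has_sum (minimum n + shift * 1)) (weight_idx (N n))"
    by (intro has_sum_add has_sum_cmult_right has_sum_minimum discrete_holonomicD(2)[OF holonomic])
  then show "((\<lambda>(i, j, l). \<mu> n i j l * energy (phase_point (N n) (\<tau> n) (i, j, l)))
      has_sum (minimum n + shift)) (weight_idx (N n))"
    by (simp add: energy_def phase_point_def case_prod_unfold algebra_simps)
qed

definition energy_bound :: real where
  "energy_bound = L (to_torus 0) 0 + shift"

lemma integrable_energy: "integrable (M n) energy"
  and integral_energy_le: "(\<integral>z. energy z \<partial>M n) \<le> energy_bound"
  using integral_energy[of n] minimum_le_rest[of n]
  by (auto simp: has_bochner_integral_iff energy_bound_def)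

lemma energy_bound_nonneg: "energy_bound \<ge> 0"
  using integral_energy_le[of 0] Bochner_Integration.integral_nonneg[of "M 0" energy, OF energy_nonneg] by linarith

lemma minimum_bounded: "\<bar>minimum n\<bar> \<le> energy_bound + shift"
proof -
  have "(\<integral>z. energy z \<partial>M n) = minimum n + shift"
    using integral_energy[of n] by (simp add: has_bochner_integral_iff)
  moreover have "0 \<le> (\<integral>z. energy z \<partial>M n)"
    by (rule Bochner_Integration.integral_nonneg) (rule energy_nonneg)
  ultimately show ?thesis
    using integral_energy_le[of n] shift(1) energy_bound_nonneg by linarith
qed

text \<open>The Markov inequality for the energy, which exceeds \<open>R\<close> wherever the speed
  does; positions already range over a compact space.\<close>

lemma tight: "tight_seq M"
  unfolding tight_seq_def
proof (intro conjI allI impI)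
  fix \<epsilon> :: real assume "\<epsilon> > 0"
  \<comment> \<open>The summand 1 keeps the radius positive when the energy bound is 0.\<close>
  define R where "R = energy_bound / \<epsilon> + 1"
  have "R > 0" using energy_bound_nonneg \<open>\<epsilon> > 0\<close> by (simp add: R_def add_nonneg_pos)
  let ?K = "UNIV \<times> cball 0 R :: ('d torus \<times> (real^'d)) set"
  have "measure (M n) ?K \<ge> 1 - \<epsilon>" for n
  proof -
    interpret prob_space "M n" using borel_probability_M by (simp add: borel_probability_def)
    have sets: "?K \<in> sets (M n)"
      using borel_closed[OF closed_Times[OF closed_UNIV closed_cball]] by (simp add: sets_reconstruction)
    have "1 - energy z / R \<le> indicator ?K z" for z
    proof (cases "z \<in> ?K")
      case True
      then show ?thesis using energy_nonneg[of z] \<open>R > 0\<close> by simp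
    next
      case False
      then have "R \<le> norm (snd z)" by (cases z) auto
      also have "\<dots> \<le> energy z" using energy_ge[of "snd z" "fst z"] by simp
      finally show ?thesis using \<open>R > 0\<close> False by simp
    qed
    then have "(\<integral>z. 1 - energy z / R \<partial>M n) \<le> (\<integral>z. indicator ?K z \<partial>M n)"
      using sets by (intro integral_mono Bochner_Integration.integrable_diff integrable_energy
          integrable_divide_zero integrable_real_indicator) (auto simp: emeasure_eq_measure)
    also have "\<dots> = measure (M n) ?K" using sets by simp
    also have "(\<integral>z. 1 - energy z / R \<partial>M n) = 1 - (\<integral>z. energy z \<partial>M n) / R"
      using integrable_energy[of n] prob_space by simp
    finally have "1 - (\<integral>z. energy z \<partial>M n) / R \<le> measure (M n) ?K" .
    moreover have "(\<integral>z. energy z \<partial>M n) / R \<le> \<epsilon>"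
    proof -
      have "(\<integral>z. energy z \<partial>M n) \<le> \<epsilon> * R"
        using integral_energy_le[of n] \<open>\<epsilon> > 0\<close> by (simp add: R_def algebra_simps)
      then show ?thesis using \<open>R > 0\<close> by (simp add: divide_le_eq)
    qed
    ultimately show ?thesis by linarith
  qed
  moreover have "compact ?K" by (intro compact_Times compact_UNIV_torus compact_cball)
  ultimately show "\<exists>K. compact K \<and> (\<forall>n. measure (M n) K \<ge> 1 - \<epsilon>)" by blast
qed (rule borel_probability_M)

section \<open>Comparison with arbitrary closed measures\<close>

lemma eventually_minimum_le:
  assumes closed: "closed_measure \<nu>" and int: "integrable \<nu> (\<lambda>(x, v). L x v)" and "\<delta> > 0"
  shows "\<forall>\<^sub>F n in sequentially. minimum n \<le> (\<integral>(x, v). L x v \<partial>\<nu>) + \<delta>"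
proof -
  interpret prob_space \<nu> using closed by (simp add: closed_measure_def borel_probability_def)
  have "\<exists>u. grid_potential L (N n) (\<tau> n) (minimum n) u" for n
  proof (rule discrete_potential[OF N[of n], of "cost n" "minimum n"])
    show "minimum n \<le> s" if "\<nu> \<in> discrete_holonomic (N n)"
      "((\<lambda>(i, j, l). cost n i j l * \<nu> i j l) has_sum s) (weight_idx (N n))" for \<nu> s
      using that by (rule minimum_le)
  qed (auto simp: grid_potential_def)
  then obtain u where "\<And>n. grid_potential L (N n) (\<tau> n) (minimum n) (u n)" by metis
  from global_subsolution[OF N \<tau> lim\<tau> limh limq minimum_bounded this \<open>\<delta> > 0\<close>] show ?thesis
  proof eventually_elim
    case (elim n)
    then obtain \<phi> G where "C1_torus_gradient \<phi> G" and sub: "\<And>x v. v \<bullet> G x \<le> L x v - minimum n + \<delta>"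
      by metis
    then have 0: "has_bochner_integral \<nu> (\<lambda>(x, v). v \<bullet> G x) 0"
      using closed by (auto simp: closed_measure_def)
    then have "0 = (\<integral>(x, v). v \<bullet> G x \<partial>\<nu>)" by (simp add: has_bochner_integral_iff)
    also have "\<dots> \<le> (\<integral>z. (\<lambda>(x, v). L x v) z + (\<delta> - minimum n) \<partial>\<nu>)"
    proof (rule integral_mono)
      show "integrable \<nu> (\<lambda>(x, v). v \<bullet> G x)" using 0 by (simp add: has_bochner_integral_iff)
      show "(\<lambda>(x, v). v \<bullet> G x) z \<le> (\<lambda>(x, v). L x v) z + (\<delta> - minimum n)" for z
        using sub[of "snd z" "fst z"] by (simp add: split_beta)
    qed (use int in auto)
    also have "\<dots> = (\<integral>(x, v). L x v \<partial>\<nu>) + (\<delta> - minimum n)"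
      using int prob_space by simp
    finally show ?case by linarith
  qed
qed

text \<open>Lower semicontinuity through truncations. The bound \<open>A\<close> is left free
  because two choices occur: a crude one for integrability and the action of a competitor for
  optimality.\<close>

lemma limit_energy_le:
  assumes \<nu>: "borel_probability \<nu>" and r: "strict_mono r" and narrow: "narrowly_converges (\<lambda>k. M (r k)) \<nu>"
    and A: "\<And>\<delta>. \<delta> > 0 \<Longrightarrow> \<forall>\<^sub>F n in sequentially. minimum n \<le> A + \<delta>"
  shows "integrable \<nu> energy" "(\<integral>z. energy z \<partial>\<nu>) \<le> A + shift"
proof -
  have "(\<integral>z. min (energy z) (real j) \<partial>\<nu>) \<le> A + shift" for j
  proof (rule field_le_epsilon)
    fix \<delta> :: real assume "\<delta> > 0"
    have "0 \<le> min (energy z) (real j)" for z using energy_nonneg[of z] by simp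
    moreover have "continuous_on UNIV (\<lambda>z. min (energy z) (real j))"
      by (intro continuous_intros continuous_energy)
    ultimately have trunc: "continuous_on UNIV (\<lambda>z. min (energy z) (real j))"
      "\<And>z. \<bar>min (energy z) (real j)\<bar> \<le> real j" by (auto simp: abs_of_nonneg)
    then have "bounded (range (\<lambda>z. min (energy z) (real j)))"
      by (auto simp: bounded_iff)
    then have "(\<lambda>k. \<integral>z. min (energy z) (real j) \<partial>M (r k)) \<longlonglongrightarrow> (\<integral>z. min (energy z) (real j) \<partial>\<nu>)"
      using narrow trunc(1) by (simp add: narrowly_converges_def)
    then show "(\<integral>z. min (energy z) (real j) \<partial>\<nu>) \<le> A + shift + \<delta>"
    proof (rule tendsto_upperbound)
      show "\<forall>\<^sub>F k in sequentially. (\<integral>z. min (energy z) (real j) \<partial>M (r k)) \<le> A + shift + \<delta>"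
        using eventually_subseq[OF r A[OF \<open>\<delta> > 0\<close>]]
      proof eventually_elim
        case (elim k)
        have "(\<integral>z. min (energy z) (real j) \<partial>M (r k)) \<le> (\<integral>z. energy z \<partial>M (r k))"
          using integrable_bounded_continuous[OF borel_probability_M trunc]
          by (intro integral_mono integrable_energy) auto
        also have "\<dots> = minimum (r k) + shift"
          using integral_energy[of "r k"] by (simp add: has_bochner_integral_iff)
        finally show ?case using elim by linarith
      qed
    qed simp
  qed
  from integral_truncation[OF \<nu> continuous_energy energy_nonneg this]
  show "integrable \<nu> energy" "(\<integral>z. energy z \<partial>\<nu>) \<le> A + shift" by auto
qed

section \<open>Closedness of narrow limits\<close>

lemma test_function_quotient:
  assumes C1: "C1_torus_gradient \<phi> G" and "\<eta> > 0"
  shows "\<forall>\<^sub>F n in sequentially. \<forall>y v.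
    \<bar>v \<bullet> G (to_torus y) - (\<phi> (to_torus (y + \<tau> n *\<^sub>R v)) - \<phi> (to_torus y)) / \<tau> n\<bar> \<le> \<eta> * energy (to_torus y, v)"
proof -
  let ?f = "\<lambda>y. \<phi> (to_torus y)" and ?G = "\<lambda>y. G (to_torus y)"
  have deriv: "GDERIV ?f y :> ?G y" for y
    using C1 by (simp add: C1_torus_gradient_def)
  have cont: "continuous_on UNIV G"
    using C1 by (simp add: C1_torus_gradient_def)
  have contG: "continuous_on UNIV ?G"
    by (rule continuous_on_compose2[OF cont continuous_to_torus]) auto
  obtain B where B: "B > 0" "\<And>y. norm (?G y) \<le> B"
    using periodic_bounded[OF contG] by auto
  obtain d where d: "d > 0" "\<And>y h. norm h \<le> d \<Longrightarrow> \<bar>?f (y + h) - ?f y - ?G y \<bullet> h\<bar> \<le> \<eta> * norm h"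
    using periodic_GDERIV_remainder[OF deriv contG _ \<open>\<eta> > 0\<close>] by auto
  \<comment> \<open>When the step \<open>\<tau> * v\<close> is longer than \<open>d\<close>, both
    terms are at most \<open>B * norm v\<close>. Smallness of \<open>\<tau>\<close> then forces
    \<open>norm v \<ge> T\<close>, and the extra slope 1 absorbs \<open>T\<close>.\<close>
  obtain T where T: "T \<ge> 0" "\<And>x v. (2 * B + 1) * norm v - T \<le> \<eta> * energy (x, v)"
    using energy_tail[OF \<open>\<eta> > 0\<close>, of "2 * B + 1"] B(1) by auto
  have "\<forall>\<^sub>F n in sequentially. \<tau> n < d / (T + 1)"
    by (rule order_tendstoD[OF lim\<tau>]) (use d T in auto)
  then show ?thesis
  proof eventually_elim
    case (elim n)
    let ?\<tau> = "\<tau> n"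
    have \<tau>0: "?\<tau> > 0" by (rule \<tau>)
    show ?case
    proof (intro allI)
      fix y v
      let ?q = "(?f (y + ?\<tau> *\<^sub>R v) - ?f y) / ?\<tau>"
      show "\<bar>v \<bullet> ?G y - ?q\<bar> \<le> \<eta> * energy (to_torus y, v)"
      proof (cases "norm (?\<tau> *\<^sub>R v) \<le> d")
        case True
        have "v \<bullet> ?G y - ?q = - ((?f (y + ?\<tau> *\<^sub>R v) - ?f y - ?G y \<bullet> (?\<tau> *\<^sub>R v)) / ?\<tau>)"
          using \<tau>0 by (simp add: diff_divide_distrib inner_commute)
        then have "\<bar>v \<bullet> ?G y - ?q\<bar> = \<bar>?f (y + ?\<tau> *\<^sub>R v) - ?f y - ?G y \<bullet> (?\<tau> *\<^sub>R v)\<bar> / ?\<tau>"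
          using \<tau>0 by simp
        also have "\<dots> \<le> \<eta> * norm (?\<tau> *\<^sub>R v) / ?\<tau>"
          using \<tau>0 by (intro divide_right_mono d(2)[OF True]) auto
        also have "\<dots> = \<eta> * norm v" using \<tau>0 by simp
        also have "\<dots> \<le> \<eta> * energy (to_torus y, v)"
          using energy_ge \<open>\<eta> > 0\<close> by (intro mult_left_mono) auto
        finally show ?thesis .
      next
        case False
        have "\<bar>?q\<bar> = \<bar>?f (y + ?\<tau> *\<^sub>R v) - ?f y\<bar> / ?\<tau>" using \<tau>0 by simp
        also have "\<dots> \<le> B * norm (?\<tau> *\<^sub>R v) / ?\<tau>"
          by (intro divide_right_mono GDERIV_lipschitz[OF deriv B(2)]) (use \<tau>0 in auto)
        also have "\<dots> = B * norm v" using \<tau>0 by simp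
        finally have q: "\<bar>?q\<bar> \<le> B * norm v" .
        have "\<bar>v \<bullet> ?G y\<bar> \<le> norm v * norm (?G y)" by (rule Cauchy_Schwarz_ineq2)
        also have "\<dots> \<le> norm v * B" by (intro mult_left_mono B(2)) auto
        also have "\<dots> = B * norm v" by (rule mult.commute)
        finally have "\<bar>v \<bullet> ?G y - ?q\<bar> \<le> 2 * B * norm v"
          using q abs_triangle_ineq4[of "v \<bullet> ?G y" ?q] by linarith
        moreover have "T \<le> norm v"
        proof -
          have "?\<tau> * (T + 1) < d" using elim T(1) by (simp add: pos_less_divide_eq)
          also have "d < ?\<tau> * norm v" using False \<tau>0 by simp
          finally have "T + 1 < norm v" using \<tau>0 by (simp only: mult_less_cancel_left_pos)
          then show ?thesis by simp
        qed
        ultimately show ?thesis using T(2)[of v "to_torus y"] by (simp add: distrib_right)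
      qed
    qed
  qed
qed

lemma phase_point_endpoint:
  "to_torus (grid_point (N n) i + \<tau> n *\<^sub>R velocity (N n) (\<tau> n) i j l) = to_torus (grid_point (N n) j)"
proof -
  have "grid_point (N n) i + \<tau> n *\<^sub>R velocity (N n) (\<tau> n) i j l = grid_point (N n) j + zvec l"
    using \<tau>[of n] by (simp add: velocity_def zvec_def)
  then show ?thesis by simp
qed

lemma almost_closed:
  assumes C1: "C1_torus_gradient \<phi> G" and "\<eta> > 0"
  shows "\<forall>\<^sub>F n in sequentially. \<bar>\<integral>(x, v). v \<bullet> G x \<partial>M n\<bar> \<le> \<eta> * energy_bound"
  using test_function_quotient[OF assms]
proof eventually_elim
  case (elim n)
  let ?e = "phase_point (N n) (\<tau> n)" and ?W = "weight_idx (N n)"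
  let ?w = "\<lambda>(i, j, l). \<mu> n i j l" and ?g = "\<lambda>i. \<phi> (to_torus (grid_point (N n) i))"
  let ?q = "\<lambda>(i, j, l). (?g j - ?g i) / \<tau> n" and ?f = "\<lambda>(x, v). v \<bullet> G x"
  \<comment> \<open>Holonomy is tested with the restriction of \<open>\<phi>\<close> to the grid:
    every edge ends at a grid point modulo the lattice.\<close>
  have "((\<lambda>e. (1 / \<tau> n) * (\<lambda>(i, j, l). \<mu> n i j l * (?g j - ?g i)) e) has_sum (1 / \<tau> n) * 0) ?W"
    by (intro has_sum_cmult_right discrete_holonomic_test holonomic)
  then have q0: "((\<lambda>e. ?w e * ?q e) has_sum 0) ?W"
    by (simp add: case_prod_unfold)
  have E: "((\<lambda>e. ?w e * energy (?e e)) has_sum (\<integral>z. energy z \<partial>M n)) ?W"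
  proof -
    have "((\<lambda>e. (\<lambda>(i, j, l). cost n i j l * \<mu> n i j l) e + shift * ?w e)
        has_sum (minimum n + shift * 1)) ?W"
      by (intro has_sum_add has_sum_cmult_right has_sum_minimum discrete_holonomicD(2)[OF holonomic])
    then show ?thesis
      using integral_energy[of n]
      by (simp add: has_bochner_integral_iff energy_def phase_point_def case_prod_unfold algebra_simps)
  qed
  have pointwise: "\<bar>?w e * (?f (?e e) - ?q e)\<bar> \<le> ?w e * (\<eta> * energy (?e e))" if "e \<in> ?W" for e
  proof -
    obtain i j l where e: "e = (i, j, l)" by (metis prod_cases3)
    have "\<bar>?f (?e e) - ?q e\<bar> \<le> \<eta> * energy (?e e)"
      using elim[rule_format, where y="grid_point (N n) i" and v="velocity (N n) (\<tau> n) i j l"]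
      unfolding phase_point_endpoint by (simp add: e phase_point_def)
    moreover have "0 \<le> ?w e" using discrete_holonomicD(1)[OF holonomic] that by (simp add: e)
    ultimately show ?thesis by (simp add: abs_mult mult_left_mono)
  qed
  \<comment> \<open>Domination by the energy gives summability of the error; summability of the
    series for \<open>v \<bullet> G x\<close> follows by adding back the quotient.\<close>
  have E\<eta>: "((\<lambda>e. ?w e * (\<eta> * energy (?e e))) has_sum (\<eta> * (\<integral>z. energy z \<partial>M n))) ?W"
    using has_sum_cmult_right[OF E, of \<eta>] by (simp add: mult_ac)
  then have "(\<lambda>e. norm (?w e * (?f (?e e) - ?q e))) summable_on ?W"
    by (intro Infinite_Sum.abs_summable_on_comparison_test'[OF has_sum_imp_summable[OF E\<eta>]]) (use pointwise in auto)
  then have "(\<lambda>e. ?w e * (?f (?e e) - ?q e)) summable_on ?W"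
    by (rule abs_summable_summable)
  then obtain s where s: "((\<lambda>e. ?w e * (?f (?e e) - ?q e)) has_sum s) ?W"
    by (auto simp: summable_on_def)
  have neg: "((\<lambda>e. - (?w e * (?f (?e e) - ?q e))) has_sum - s) ?W"
    using s by (simp add: has_sum_uminus)
  have "\<bar>s\<bar> \<le> \<eta> * (\<integral>z. energy z \<partial>M n)"
  proof (rule abs_leI)
    show "s \<le> \<eta> * (\<integral>z. energy z \<partial>M n)"
      by (rule has_sum_mono[OF s E\<eta>]) (use pointwise abs_le_D1 in blast)
    show "- s \<le> \<eta> * (\<integral>z. energy z \<partial>M n)"
      by (rule has_sum_mono[OF neg E\<eta>]) (use pointwise abs_le_D2 in blast)
  qed
  moreover have "\<eta> * (\<integral>z. energy z \<partial>M n) \<le> \<eta> * energy_bound"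
    using integral_energy_le \<open>\<eta> > 0\<close> by (intro mult_left_mono) auto
  moreover have "has_bochner_integral (M n) ?f s"
  proof (rule reconstruction_integral[OF holonomic])
    have "continuous_on UNIV G" using C1 by (simp add: C1_torus_gradient_def)
    then have "continuous_on UNIV ?f"
      unfolding split_beta by (auto intro!: continuous_intros continuous_on_compose2[of UNIV G])
    then show "?f \<in> borel_measurable borel" by (rule borel_measurable_continuous_onI)
    have "((\<lambda>e. ?w e * (?f (?e e) - ?q e) + ?w e * ?q e) has_sum (s + 0)) ?W"
      by (intro has_sum_add s q0)
    then show "((\<lambda>(i, j, l). \<mu> n i j l * ?f (?e (i, j, l))) has_sum s) ?W"
      by (simp add: case_prod_unfold algebra_simps)
  qed
  ultimately show ?case by (simp add: has_bochner_integral_iff)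
qed

text \<open>The integrand grows linearly in \<open>v\<close>, so narrow convergence applies only to
  its truncation. The energy controls the truncation error uniformly along the sequence and in the
  limit.\<close>

lemma limit_closed:
  assumes \<nu>: "borel_probability \<nu>" and r: "strict_mono r" and narrow: "narrowly_converges (\<lambda>k. M (r k)) \<nu>"
    and int: "integrable \<nu> energy"
  shows "closed_measure \<nu>"
  unfolding closed_measure_def
proof (intro conjI allI impI)
  fix \<phi> :: "'d torus \<Rightarrow> real" and G assume C1: "C1_torus_gradient \<phi> G"
  define f where "f = (\<lambda>(x, v). v \<bullet> G x)"
  have contG: "continuous_on UNIV G" using C1 by (simp add: C1_torus_gradient_def)
  have cont: "continuous_on UNIV f"
    unfolding f_def split_beta by (auto intro!: continuous_intros continuous_on_compose2[OF contG])
  have "compact (range G)" by (rule compact_continuous_image[OF contG compact_UNIV_torus])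
  then obtain B where B: "B > 0" "\<And>x. norm (G x) \<le> B"
    using compact_imp_bounded bounded_pos by (metis rangeI)
  have fB: "\<bar>f z\<bar> \<le> B * norm (snd z)" for z
  proof -
    have "\<bar>snd z \<bullet> G (fst z)\<bar> \<le> norm (snd z) * norm (G (fst z))" by (rule Cauchy_Schwarz_ineq2)
    also have "\<dots> \<le> norm (snd z) * B" by (intro mult_left_mono B(2)) auto
    finally show ?thesis by (simp add: f_def split_beta mult.commute)
  qed
  have fE: "\<bar>f z\<bar> \<le> B * energy z" for z
  proof -
    have "B * norm (snd z) \<le> B * energy z"
      using energy_ge[of "snd z" "fst z"] B(1) by simp
    then show ?thesis using fB[of z] by linarith
  qed
  have intf: "integrable P f" if "borel_probability P" "integrable P energy" for P
    by (rule abs_integral_le(1)[OF borel_measurable_continuous[OF that(1) cont] _ fE])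
       (use that(2) in simp)
  \<comment> \<open>One energy bound comes from approximate closedness, one from truncation along
    the sequence, and the integral from truncation in the limit.\<close>
  define C where "C = 2 * energy_bound + (\<integral>z. energy z \<partial>\<nu>)"
  have small: "\<bar>\<integral>z. f z \<partial>\<nu>\<bar> \<le> \<eta> * C" if "\<eta> > 0" for \<eta>
  proof -
    obtain T where T: "T \<ge> 0" "\<And>x v. B * norm v - T \<le> \<eta> * energy (x, v)"
      using energy_tail[OF \<open>\<eta> > 0\<close> B(1)] by auto
    define g where "g = (\<lambda>z. max (- T) (min T (f z)))"
    have contg: "continuous_on UNIV g" unfolding g_def by (intro continuous_intros cont)
    have gT: "\<bar>g z\<bar> \<le> T" for z using T(1) by (auto simp: g_def)
    have fg: "\<bar>f z - g z\<bar> \<le> \<eta> * energy z" for z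
    proof -
      have "0 \<le> \<eta> * energy z" using energy_nonneg \<open>\<eta> > 0\<close> by simp
      moreover have "\<bar>f z\<bar> - T \<le> \<eta> * energy z"
        using fB[of z] T(2)[of "snd z" "fst z"] by simp
      ultimately show ?thesis by (auto simp: g_def)
    qed
    have diff: "\<bar>(\<integral>z. f z \<partial>P) - (\<integral>z. g z \<partial>P)\<bar> \<le> \<eta> * (\<integral>z. energy z \<partial>P)"
      if P: "borel_probability P" "integrable P energy" for P
    proof -
      have intg: "integrable P g" by (rule integrable_bounded_continuous[OF P(1) contg gT])
      have "\<bar>\<integral>z. f z - g z \<partial>P\<bar> \<le> (\<integral>z. \<eta> * energy z \<partial>P)"
      proof (rule abs_integral_le(2)[OF _ _ fg])
        show "(\<lambda>z. f z - g z) \<in> borel_measurable P"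
          using intf[OF P] intg by (intro borel_measurable_diff borel_measurable_integrable)
      qed (use P(2) in simp)
      then show ?thesis
        using intf[OF P] intg P(2) by simp
    qed
    have "(\<lambda>k. \<integral>z. g z \<partial>M (r k)) \<longlonglongrightarrow> (\<integral>z. g z \<partial>\<nu>)"
      using narrow contg gT by (auto simp: narrowly_converges_def bounded_iff)
    then have "(\<lambda>k. \<bar>\<integral>z. g z \<partial>M (r k)\<bar>) \<longlonglongrightarrow> \<bar>\<integral>z. g z \<partial>\<nu>\<bar>"
      by (rule tendsto_rabs)
    then have "\<bar>\<integral>z. g z \<partial>\<nu>\<bar> \<le> \<eta> * (2 * energy_bound)"
    proof (rule tendsto_upperbound)
      show "\<forall>\<^sub>F k in sequentially. \<bar>\<integral>z. g z \<partial>M (r k)\<bar> \<le> \<eta> * (2 * energy_bound)"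
        using eventually_subseq[OF r almost_closed[OF C1 \<open>\<eta> > 0\<close>, folded f_def]]
      proof eventually_elim
        case (elim k)
        have "\<eta> * (\<integral>z. energy z \<partial>M (r k)) \<le> \<eta> * energy_bound"
          using integral_energy_le \<open>\<eta> > 0\<close> by (intro mult_left_mono) auto
        then show ?case
          using elim diff[OF borel_probability_M integrable_energy, of "r k"] by linarith
      qed
    qed simp
    then show ?thesis
      using diff[OF \<nu> int] by (simp add: C_def distrib_left)
  qed
  have "(\<integral>z. f z \<partial>\<nu>) = 0"
  proof (rule ccontr)
    assume *: "(\<integral>z. f z \<partial>\<nu>) \<noteq> 0"
    \<comment> \<open>With \<open>\<eta>\<close> equal to the absolute integral divided by
      \<open>c\<close>, the estimate bounds that absolute integral by half of itself.\<close>
    define c where "c = 2 * (\<bar>C\<bar> + 1)"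
    have "c > 0" "C \<le> c / 2" by (auto simp: c_def)
    have "\<bar>\<integral>z. f z \<partial>\<nu>\<bar> / c > 0" using * \<open>c > 0\<close> by simp
    then have "\<bar>\<integral>z. f z \<partial>\<nu>\<bar> \<le> \<bar>\<integral>z. f z \<partial>\<nu>\<bar> / c * C" by (rule small)
    also have "\<dots> \<le> \<bar>\<integral>z. f z \<partial>\<nu>\<bar> / c * (c / 2)"
      using \<open>c > 0\<close> \<open>C \<le> c / 2\<close> by (intro mult_left_mono) auto
    also have "\<dots> = \<bar>\<integral>z. f z \<partial>\<nu>\<bar> / 2" using \<open>c > 0\<close> by simp
    finally show False using * by simp
  qed
  then show "has_bochner_integral \<nu> (\<lambda>(x, v). v \<bullet> G x) 0"
    using intf[OF \<nu> int] by (simp add: has_bochner_integral_iff f_def)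
qed (rule \<nu>)

lemma accumulation_point_mather:
  assumes "narrow_accumulation_point M \<nu>"
  shows "mather_measure L \<nu>"
proof -
  obtain r where \<nu>: "borel_probability \<nu>" and r: "strict_mono r"
    and narrow: "narrowly_converges (\<lambda>k. M (r k)) \<nu>"
    using assms by (auto simp: narrow_accumulation_point_def)
  interpret prob_space \<nu> using \<nu> by (simp add: borel_probability_def)
  have L: "(\<lambda>(x, v). L x v) = (\<lambda>z. energy z - shift)"
    by (auto simp: energy_def)
  \<comment> \<open>The crude bound by the resting action gives integrability of the energy, which
    closedness of the limit presupposes.\<close>
  have "\<forall>\<^sub>F n in sequentially. minimum n \<le> L (to_torus 0) 0 + \<delta>" if "\<delta> > 0" for \<delta>
  proof (intro always_eventually allI)
    show "minimum n \<le> L (to_torus 0) 0 + \<delta>" for n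
      using minimum_le_rest[of n] that by linarith
  qed
  then have int: "integrable \<nu> energy"
    by (rule limit_energy_le(1)[OF \<nu> r narrow])
  then have intL: "integrable \<nu> (\<lambda>(x, v). L x v)" unfolding L by simp
  have "action L \<nu> \<le> action L \<nu>'" if closed: "closed_measure \<nu>'" for \<nu>'
  proof (cases "integrable \<nu>' (\<lambda>(x, v). L x v)")
    case True
    have "(\<integral>z. energy z \<partial>\<nu>) \<le> (\<integral>(x, v). L x v \<partial>\<nu>') + shift"
      by (rule limit_energy_le(2)[OF \<nu> r narrow]) (rule eventually_minimum_le[OF closed True])
    moreover have "(\<integral>(x, v). L x v \<partial>\<nu>) = (\<integral>z. energy z \<partial>\<nu>) - shift"
      unfolding L using int prob_space by simp
    ultimately show ?thesis using True intL by (simp add: action_def)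
  qed (simp add: action_def)
  then show ?thesis
    using limit_closed[OF \<nu> r narrow int] by (simp add: mather_measure_def)
qed

end

theorem proposition5p1:
  fixes H :: "'d::finite torus \<Rightarrow> real^'d \<Rightarrow> real"
    and N :: "nat \<Rightarrow> nat"
    and h \<tau> :: "nat \<Rightarrow> real"
    and \<mu> :: "nat \<Rightarrow> 'd weights"
  assumes "tonelli_hamiltonian H"
    and "\<And>n. N n \<ge> 1"
    and "\<And>n. h n = 1 / real (N n)"
    and "\<And>n. \<tau> n > 0"
    and "\<tau> \<longlonglongrightarrow> 0"
    and "h \<longlonglongrightarrow> 0"
    and "(\<lambda>n. h n / \<tau> n) \<longlonglongrightarrow> 0"
    and "\<And>n. discrete_mather_measure (lagrangian H) (N n) (\<tau> n) (\<mu> n)"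
  shows "tight_seq (\<lambda>n. reconstruction (N n) (\<tau> n) (\<mu> n)) \<and>
    (\<forall>\<nu>. narrow_accumulation_point (\<lambda>n. reconstruction (N n) (\<tau> n) (\<mu> n)) \<nu>
          \<longrightarrow> mather_measure (lagrangian H) \<nu>)"
proof -
  have cont: "continuous_on UNIV (\<lambda>(x, p). H x p)"
    by (rule tonelli_hamiltonian_continuous[OF assms(1)])
  have super: "superlinear H"
    using assms(1) by (simp add: tonelli_hamiltonian_def)
  have h: "h = (\<lambda>n. 1 / real (N n))"
    using assms(3) by (simp add: fun_eq_iff)
  interpret discrete_mather_sequence "lagrangian H" N \<tau> \<mu>
    using continuous_lagrangian[OF cont super] lagrangian_superlinear[OF cont super] assms
    by unfold_locales (simp_all add: h)
  show ?thesis
    using tight accumulation_point_mather by blast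
qed

end
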